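(* Let $\mathcal H$ be a one-dimensional $2$-color cellular automaton with an arbitrary initial configuration, a local rule $h$, and (constant) radius $r$. Then the configuration $X_n^{\mathcal H}$ at generation $n$ can be computed in $O(n^2/\log n)$ time.
   Context: A one-dimensional $2$-color cellular automaton of radius $r$ has a local rule $h:\{0,1\}^{2r+1}\to\{0,1\}$ and an initial configuration $X_1=(x^1_i)_{i\in\mathbb Z}$; generation $n+1$ is $X_{n+1}=(x^{n+1}_i)$ with $x^{n+1}_i=h(x^n_{i-r},\dots,x^n_{i+r})$, so $X_n$ results from $n-1$ global updates. Configurations are stored as finite arrays, the configuration at generation $n$ having length $O(n)$. Complexity is measured in the standard RAM model (unit-cost access to memory addresses of size $O(\log n)$), with $r$ regarded as a constant. For comparison, naive row-by-row simulation takes $O(n^2)$ time. *)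

theory Defs
  imports Complex_Main "HOL-Library.Landau_Symbols"
begin

text \<open>
  A local rule of radius \<open>r\<close> is a function on bit lists, of which only the values on lists of
  length \<open>2 * r + 1\<close> matter: the neighbourhood of cell \<open>i\<close>, listed from \<open>i - r\<close> to \<open>i + r\<close>.
\<close>

type_synonym config = "int \<Rightarrow> bool"

definition neighbourhood :: "nat \<Rightarrow> config \<Rightarrow> int \<Rightarrow> bool list" where
  "neighbourhood r X i = map (\<lambda>j. X (i - int r + int j)) [0..<2 * r + 1]"

definition global_update :: "nat \<Rightarrow> (bool list \<Rightarrow> bool) \<Rightarrow> config \<Rightarrow> config" where
  "global_update r h X = (\<lambda>i. h (neighbourhood r X i))"

text \<open>Generations are counted from 1; only \<open>n \<ge> 1\<close> is meaningful.\<close>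

definition generation :: "nat \<Rightarrow> (bool list \<Rightarrow> bool) \<Rightarrow> config \<Rightarrow> nat \<Rightarrow> config" where
  "generation r h X n = (global_update r h ^^ (n - 1)) X"

text \<open>
  A machine with registers and a separate random access memory. \<open>LoadI a b\<close> reads into
  register \<open>a\<close> the memory word whose address is in register \<open>b\<close>; \<open>StoreI a b\<close> writes register \<open>b\<close>
  to the memory word whose address is in register \<open>a\<close>. The arithmetic is that of the Cook-Reckhow
  RAM, addition and subtraction, with subtraction truncated at 0. A program halts when the program counter leaves it.
\<close>

datatype instr =
    ConstI nat nat
  | AddI nat nat nat
  | SubI nat nat nat
  | LoadI nat nat
  | StoreI nat nat
  | JumpZeroI nat nat

datatype ram_state = Ram_State (pc: nat) (reg: "nat \<Rightarrow> nat") (mem: "nat \<Rightarrow> nat")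

fun exec_instr :: "instr \<Rightarrow> ram_state \<Rightarrow> ram_state" where
  "exec_instr (ConstI a k) (Ram_State l R M) = Ram_State (Suc l) (R(a := k)) M"
| "exec_instr (AddI a b c) (Ram_State l R M) = Ram_State (Suc l) (R(a := R b + R c)) M"
| "exec_instr (SubI a b c) (Ram_State l R M) = Ram_State (Suc l) (R(a := R b - R c)) M"
| "exec_instr (LoadI a b) (Ram_State l R M) = Ram_State (Suc l) (R(a := M (R b))) M"
| "exec_instr (StoreI a b) (Ram_State l R M) = Ram_State (Suc l) R (M(R a := R b))"
| "exec_instr (JumpZeroI a k) (Ram_State l R M) = Ram_State (if R a = 0 then k else Suc l) R M"

definition halted :: "instr list \<Rightarrow> ram_state \<Rightarrow> bool" where
  "halted p s \<longleftrightarrow> length p \<le> pc s"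

definition step :: "instr list \<Rightarrow> ram_state \<Rightarrow> ram_state" where
  "step p s = (if halted p s then s else exec_instr (p ! pc s) s)"

definition run :: "instr list \<Rightarrow> nat \<Rightarrow> ram_state \<Rightarrow> ram_state" where
  "run p t s = (step p ^^ t) s"

text \<open>
  Words of \<open>w\<close> bits. Without this restriction, registers could hold arbitrarily long integers at
  unit cost. Since memory is addressed through registers, it bounds the addresses as well.
\<close>

definition fits_words :: "nat \<Rightarrow> ram_state \<Rightarrow> bool" where
  "fits_words w s \<longleftrightarrow> (\<forall>k. reg s k < 2 ^ w) \<and> (\<forall>k. mem s k < 2 ^ w)"

text \<open>
  A bi-infinite configuration is stored through a finite segment, one cell per memory word. The
  cells \<open>a, \<dots>, a + m - 1\<close> of generation \<open>n\<close> depend on the cells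
  \<open>a - r * (n - 1), \<dots>, a + m - 1 + r * (n - 1)\<close> of generation 1, and this is the segment of the
  initial configuration that is given as input, starting at address 0. Registers 0 and 1 contain
  \<open>n\<close> and \<open>m\<close>; everything else is 0.
\<close>

definition input_state :: "nat \<Rightarrow> config \<Rightarrow> nat \<Rightarrow> int \<Rightarrow> nat \<Rightarrow> ram_state" where
  "input_state r X n a m =
     Ram_State 0 ((\<lambda>_. 0)(0 := n, 1 := m))
       (\<lambda>k. if k < m + 2 * r * (n - 1)
            then of_bool (X (a - int (r * (n - 1)) + int k)) else 0)"

text \<open>On halting, register 0 points to the first cell of the output array.\<close>

definition stores_segment :: "ram_state \<Rightarrow> config \<Rightarrow> int \<Rightarrow> nat \<Rightarrow> bool" where
  "stores_segment s Y a m \<longleftrightarrow> (\<forall>k<m. mem s (reg s 0 + k) = of_bool (Y (a + int k)))"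

definition computes_generation ::
    "instr list \<Rightarrow> nat \<Rightarrow> (bool list \<Rightarrow> bool) \<Rightarrow> config \<Rightarrow> nat \<Rightarrow> int \<Rightarrow> nat \<Rightarrow> nat \<Rightarrow> nat \<Rightarrow> bool" where
  "computes_generation p r h X n a m t w \<longleftrightarrow>
     (let s = input_state r X n a m in
        halted p (run p t s) \<and>
        (\<forall>u\<le>t. fits_words w (run p u s)) \<and>
        stores_segment (run p t s) (generation r h X n) a m)"

end

theory Submission
  imports Defs "HOL-Real_Asymp.Real_Asymp"
begin

text \<open>
  Listing the neighbourhood of a cell with the cell at its right end turns one generation into a
  transducer that reads a row from left to right and remembers the last \<open>2 * r + 1\<close> bits. Composing
  \<open>k\<close> copies of it gives a transducer with \<open>2 ^ ((2 * r + 1) * k)\<close> states that advances a row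
  by \<open>k\<close> generations in a single pass, at constant cost per cell, once its transition table is in
  memory. With \<open>k\<close> of order \<open>ln n\<close> the table has \<open>O(n)\<close> words, and about \<open>n / k\<close> passes over
  a row of length \<open>O(n)\<close> suffice; the fewer than \<open>k\<close> remaining generations are done one by one.
  Each row is overwritten in place. Its correct part loses \<open>2 * r\<close> cells on the left per
  generation, so that exactly the required segment is correct at the end.
\<close>

section \<open>A structured language over the machine\<close>

text \<open>Packing many cells into one word would call for shifts and masks, which a machine with
  only addition and subtraction does not offer. Cells therefore stay one per word, and the
  logarithmic factor is gained in the number of passes. Successor states are stored as table
  offsets, so a lookup needs only a few additions. The program may depend on \<open>r\<close> and
  \<open>h\<close> but not on \<open>n\<close>: the table for one generation is written out as code,
  the table for \<open>k + 1\<close> generations is built from the one for \<open>k\<close>, and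
  growth stops at the first level \<open>K >= 2\<close> whose table has more than \<open>n\<close>
  words. This stopping rule yields both bounds. With \<open>b = 2 ^ (2 * r + 1)\<close>, the
  inequality \<open>n < 4 * b ^ K\<close> gives \<open>K >= (ln n - ln 4) / ln b\<close>, hence few
  passes; and unless \<open>K = 2\<close> the level before had at most \<open>n\<close> words, hence
  linear tables. Building all tables costs \<open>O(n * ln n)\<close>, which is below the target.
  Words have only \<open>O(ln n)\<close> bits at every moment of the run, so the program logic
  bounds time and word size together.\<close>

datatype com =
    Block "instr list"
  | Seq com com (infixr ";;" 60)
  | IfNZ nat com
  | RepeatUntil com nat

text \<open>\<open>RepeatUntil c a\<close> executes \<open>c\<close> at least once, and again as long as register \<open>a\<close> is 0.\<close>

fun csize :: "com \<Rightarrow> nat" where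
  "csize (Block is) = length is"
| "csize (c ;; d) = csize c + csize d"
| "csize (IfNZ a c) = Suc (csize c)"
| "csize (RepeatUntil c a) = Suc (csize c)"

fun assemble :: "nat \<Rightarrow> com \<Rightarrow> instr list" where
  "assemble l (Block is) = is"
| "assemble l (c ;; d) = assemble l c @ assemble (l + csize c) d"
| "assemble l (IfNZ a c) = JumpZeroI a (Suc l + csize c) # assemble (Suc l) c"
| "assemble l (RepeatUntil c a) = assemble l c @ [JumpZeroI a l]"

lemma length_assemble [simp]: "length (assemble l c) = csize c"
  by (induction c arbitrary: l) auto

definition code_at :: "instr list \<Rightarrow> nat \<Rightarrow> instr list \<Rightarrow> bool" where
  "code_at p l is \<longleftrightarrow> (\<exists>pre post. p = pre @ is @ post \<and> length pre = l)"

lemma code_at_append: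
  assumes "code_at p l (xs @ ys)"
  shows "code_at p l xs" "code_at p (l + length xs) ys"
proof -
  obtain pre post where p: "p = pre @ (xs @ ys) @ post" "length pre = l"
    using assms unfolding code_at_def by blast
  show "code_at p l xs"
    unfolding code_at_def using p by (intro exI[of _ pre] exI[of _ "ys @ post"]) simp
  show "code_at p (l + length xs) ys"
    unfolding code_at_def using p by (intro exI[of _ "pre @ xs"] exI[of _ post]) simp
qed

lemma code_at_Cons:
  assumes "code_at p l (i # is)"
  shows "l < length p" "p ! l = i" "code_at p (Suc l) is"
proof -
  show "l < length p" "p ! l = i" using assms by (auto simp: code_at_def)
  show "code_at p (Suc l) is" using assms code_at_append(2)[of p l "[i]" "is"] by simp
qed

definition runs :: "nat \<Rightarrow> instr list \<Rightarrow> ram_state \<Rightarrow> nat \<Rightarrow> ram_state \<Rightarrow> bool" where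
  "runs w p s t s' \<longleftrightarrow> run p t s = s' \<and> (\<forall>u\<le>t. fits_words w (run p u s))"

lemma run_add: "run p (t + u) s = run p u (run p t s)"
  unfolding run_def by (subst add.commute) (simp add: funpow_add)

lemma runs_trans:
  assumes "runs w p s t s'" "runs w p s' u s''"
  shows "runs w p s (t + u) s''"
  unfolding runs_def
proof (intro conjI allI impI)
  show "run p (t + u) s = s''"
    using assms by (simp add: runs_def run_add)
  fix v assume v: "v \<le> t + u"
  show "fits_words w (run p v s)"
  proof (cases "v \<le> t")
    case True
    then show ?thesis using assms(1) by (simp add: runs_def)
  next
    case False
    then have "run p v s = run p (v - t) s'"
      using assms(1) run_add[of p t "v - t" s] by (simp add: runs_def)
    moreover have "v - t \<le> u" using v by simp
    ultimately show ?thesis using assms(2) by (simp add: runs_def)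
  qed
qed

lemma runs_0: "fits_words w s \<Longrightarrow> runs w p s 0 s"
  by (simp add: runs_def run_def)

lemma runs_1:
  assumes "code_at p l (i # is)" "fits_words w (Ram_State l R M)"
    "fits_words w (exec_instr i (Ram_State l R M))"
  shows "runs w p (Ram_State l R M) 1 (exec_instr i (Ram_State l R M))"
proof -
  have "step p (Ram_State l R M) = exec_instr i (Ram_State l R M)"
    using code_at_Cons[OF assms(1)] by (simp add: step_def halted_def)
  then show ?thesis
    using assms(2,3) by (auto simp: runs_def run_def le_Suc_eq)
qed

lemma fits_words_pc: "fits_words w (Ram_State l R M) \<longleftrightarrow> fits_words w (Ram_State l' R M)"
  by (simp add: fits_words_def)

lemma fits_words_runs: "runs w p s t s' \<Longrightarrow> fits_words w s'"
  by (auto simp: runs_def)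

section \<open>Timed Hoare triples under a word bound\<close>

type_synonym asn = "(nat \<Rightarrow> nat) \<Rightarrow> (nat \<Rightarrow> nat) \<Rightarrow> bool"

text \<open>Jumps are absolute, so a triple ranges over all programs \<open>p\<close> and positions
  \<open>l\<close> at which the fragment may sit. The number \<open>t\<close> is only an upper bound
  on the steps, while \<open>runs\<close> imposes the word bound on every intermediate
  state.\<close>

definition hoare :: "nat \<Rightarrow> asn \<Rightarrow> com \<Rightarrow> nat \<Rightarrow> asn \<Rightarrow> bool" where
  "hoare w P c t Q \<longleftrightarrow> (\<forall>p l R M. code_at p l (assemble l c) \<longrightarrow> P R M \<longrightarrow>
     fits_words w (Ram_State l R M) \<longrightarrow>
     (\<exists>u\<le>t. \<exists>R' M'. Q R' M' \<and> runs w p (Ram_State l R M) u (Ram_State (l + csize c) R' M')))"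

lemma hoareD:
  assumes "hoare w P c t Q" "code_at p l (assemble l c)" "P R M" "fits_words w (Ram_State l R M)"
  obtains u R' M' where "u \<le> t" "Q R' M'"
    "runs w p (Ram_State l R M) u (Ram_State (l + csize c) R' M')"
  using assms unfolding hoare_def by blast

text \<open>\<open>SubI\<close>, \<open>LoadI\<close> and \<open>StoreI\<close> carry no side
  condition: truncated subtraction and moving words cannot break a word bound that held before.
  Jumps are excluded because blocks are straight-line code.\<close>

fun wp :: "nat \<Rightarrow> instr list \<Rightarrow> asn \<Rightarrow> asn" where
  "wp w [] Q R M = Q R M"
| "wp w (ConstI a k # is) Q R M = (k < 2 ^ w \<and> wp w is Q (R(a := k)) M)"
| "wp w (AddI a b c # is) Q R M = (R b + R c < 2 ^ w \<and> wp w is Q (R(a := R b + R c)) M)"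
| "wp w (SubI a b c # is) Q R M = wp w is Q (R(a := R b - R c)) M"
| "wp w (LoadI a b # is) Q R M = wp w is Q (R(a := M (R b))) M"
| "wp w (StoreI a b # is) Q R M = wp w is Q R (M(R a := R b))"
| "wp w (JumpZeroI a k # is) Q R M = False"

lemma wp_append: "wp w (xs @ ys) Q R M = wp w xs (wp w ys Q) R M"
proof (induction xs arbitrary: R M)
  case (Cons x xs)
  then show ?case by (cases x) (simp_all del: fun_upd_apply)
qed simp

lemma wp_mono:
  assumes "wp w xs P R M" "\<And>R M. P R M \<Longrightarrow> Q R M"
  shows "wp w xs Q R M"
  using assms(1)
proof (induction xs arbitrary: R M)
  case (Cons x xs)
  then show ?case by (cases x) (simp_all del: fun_upd_apply)
qed (use assms(2) in simp)

lemma wp_Cons_step: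
  assumes "wp w (i # is) Q R M" "fits_words w (Ram_State l R M)"
  obtains R' M' where "exec_instr i (Ram_State l R M) = Ram_State (Suc l) R' M'"
    "fits_words w (Ram_State (Suc l) R' M')" "wp w is Q R' M'"
proof (cases i)
  case (SubI a b c)
  have "R b - R c < 2 ^ w"
    by (rule le_less_trans[of _ "R b"]) (use assms(2) in \<open>auto simp: fits_words_def\<close>)
  then show ?thesis using assms SubI that by (auto simp: fits_words_def)
qed (use assms that in \<open>auto simp: fits_words_def\<close>)

lemma runs_wp:
  assumes "wp w is Q R M" "code_at p l is" "fits_words w (Ram_State l R M)"
  shows "\<exists>R' M'. Q R' M' \<and> runs w p (Ram_State l R M) (length is) (Ram_State (l + length is) R' M')"
  using assms
proof (induction "is" arbitrary: l R M)
  case Nil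
  then show ?case by (auto intro: runs_0)
next
  case (Cons i "is")
  obtain R1 M1 where 1: "exec_instr i (Ram_State l R M) = Ram_State (Suc l) R1 M1"
    "fits_words w (Ram_State (Suc l) R1 M1)" "wp w is Q R1 M1"
    using wp_Cons_step[OF Cons.prems(1,3)] by blast
  have s: "runs w p (Ram_State l R M) 1 (Ram_State (Suc l) R1 M1)"
    using runs_1[OF Cons.prems(2,3)] 1 by simp
  obtain R' M' where "Q R' M'"
    "runs w p (Ram_State (Suc l) R1 M1) (length is) (Ram_State (Suc l + length is) R' M')"
    using Cons.IH[OF 1(3) code_at_Cons(3)[OF Cons.prems(2)] 1(2)] by blast
  then show ?case using runs_trans[OF s] by fastforce
qed

lemma hoare_Block:
  assumes "\<And>R M. P R M \<Longrightarrow> wp w is Q R M" "length is \<le> t"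
  shows "hoare w P (Block is) t Q"
  unfolding hoare_def using runs_wp[OF assms(1)] assms(2) by fastforce

lemma hoare_Seq:
  assumes "hoare w P c t Q" "hoare w Q d u S"
  shows "hoare w P (c ;; d) (t + u) S"
  unfolding hoare_def
proof (intro allI impI)
  fix p l R M
  assume a: "code_at p l (assemble l (c ;; d))" "P R M" "fits_words w (Ram_State l R M)"
  note code = code_at_append[OF a(1)[unfolded assemble.simps]]
  obtain t1 R1 M1 where 1: "t1 \<le> t" "Q R1 M1"
    "runs w p (Ram_State l R M) t1 (Ram_State (l + csize c) R1 M1)"
    using hoareD[OF assms(1) code(1) a(2,3)] by blast
  obtain t2 R2 M2 where 2: "t2 \<le> u" "S R2 M2"
    "runs w p (Ram_State (l + csize c) R1 M1) t2 (Ram_State (l + csize c + csize d) R2 M2)"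
    using hoareD[OF assms(2) code(2)[unfolded length_assemble] 1(2) fits_words_runs[OF 1(3)]] by blast
  have "t1 + t2 \<le> t + u" using 1(1) 2(1) by simp
  then show "\<exists>v\<le>t + u. \<exists>R' M'. S R' M' \<and>
      runs w p (Ram_State l R M) v (Ram_State (l + csize (c ;; d)) R' M')"
    using runs_trans[OF 1(3) 2(3)] 2(2) by (auto simp: add.assoc)
qed

lemma hoare_conseq:
  assumes "hoare w P c t Q" "\<And>R M. P' R M \<Longrightarrow> P R M" "\<And>R M. Q R M \<Longrightarrow> Q' R M" "t \<le> t'"
  shows "hoare w P' c t' Q'"
  using assms unfolding hoare_def by (meson le_trans)

lemma hoare_exI:
  assumes "\<And>x. hoare w (P x) c t Q"
  shows "hoare w (\<lambda>R M. \<exists>x. P x R M) c t Q"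
  using assms unfolding hoare_def by blast

text \<open>Brings a fact entailed by the precondition outside the triple, where it can discharge
  the premises of a rule. Invariants with an existential index are opened this way.\<close>

lemma hoare_pure:
  assumes "\<And>R M. P R M \<Longrightarrow> A" "A \<Longrightarrow> hoare w P c t Q"
  shows "hoare w P c t Q"
  using assms unfolding hoare_def by blast

lemma hoare_IfNZ:
  assumes "hoare w (\<lambda>R M. P R M \<and> R a \<noteq> 0) c t Q" "\<And>R M. P R M \<Longrightarrow> R a = 0 \<Longrightarrow> Q R M"
  shows "hoare w P (IfNZ a c) (t + 1) Q"
  unfolding hoare_def
proof (intro allI impI)
  fix p l R M
  assume a: "code_at p l (assemble l (IfNZ a c))" "P R M" "fits_words w (Ram_State l R M)"
  note code = code_at_Cons[OF a(1)[unfolded assemble.simps]]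
  have f: "fits_words w (Ram_State k R M)" for k
    using a(3) fits_words_pc by blast
  have s: "runs w p (Ram_State l R M) 1 (Ram_State (if R a = 0 then Suc l + csize c else Suc l) R M)"
    using runs_1[OF a(1)[unfolded assemble.simps] a(3)] f by auto
  show "\<exists>v\<le>t + 1. \<exists>R' M'. Q R' M' \<and>
      runs w p (Ram_State l R M) v (Ram_State (l + csize (IfNZ a c)) R' M')"
  proof (cases "R a = 0")
    case True
    then show ?thesis using s assms(2)[OF a(2)] by (intro exI[of _ 1]) auto
  next
    case False
    obtain u R1 M1 where "u \<le> t" "Q R1 M1"
      "runs w p (Ram_State (Suc l) R M) u (Ram_State (Suc l + csize c) R1 M1)"
      using hoareD[OF assms(1) code(3) _ f] a(2) False by blast
    then show ?thesis
      using runs_trans[OF s, of u "Ram_State (Suc l + csize c) R1 M1"] False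
      by (intro exI[of _ "1 + u"]) auto
  qed
qed

text \<open>The index \<open>i\<close> bounds the number of repetitions that are still to come after the next one.\<close>

lemma hoare_RepeatUntil:
  assumes "\<And>i. hoare w (I i) c t (\<lambda>R M. if R a = 0 then \<exists>j<i. I j R M else Q R M)"
  shows "hoare w (I i) (RepeatUntil c a) ((i + 1) * (t + 1)) Q"
  unfolding hoare_def
proof (intro allI impI)
  fix p l R M
  assume code: "code_at p l (assemble l (RepeatUntil c a))"
  assume "I i R M" "fits_words w (Ram_State l R M)"
  then show "\<exists>v\<le>(i + 1) * (t + 1). \<exists>R' M'. Q R' M' \<and>
      runs w p (Ram_State l R M) v (Ram_State (l + csize (RepeatUntil c a)) R' M')"
  proof (induction i arbitrary: R M rule: less_induct)
    case (less i)
    note code' = code_at_append[OF code[unfolded assemble.simps]]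
    obtain u R1 M1 where 1: "u \<le> t" "if R1 a = 0 then \<exists>j<i. I j R1 M1 else Q R1 M1"
      "runs w p (Ram_State l R M) u (Ram_State (l + csize c) R1 M1)"
      using hoareD[OF assms code'(1) less.prems] by blast
    have f: "fits_words w (Ram_State k R1 M1)" for k
      using fits_words_runs[OF 1(3)] fits_words_pc by blast
    have "runs w p (Ram_State (l + csize c) R1 M1) 1
        (Ram_State (if R1 a = 0 then l else Suc (l + csize c)) R1 M1)"
      using runs_1[OF code'(2)] f by auto
    from runs_trans[OF 1(3) this]
    have s: "runs w p (Ram_State l R M) (u + 1)
        (Ram_State (if R1 a = 0 then l else Suc (l + csize c)) R1 M1)" .
    show ?case
    proof (cases "R1 a = 0")
      case True
      then obtain j where j: "j < i" "I j R1 M1" using 1(2) by auto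
      obtain v R2 M2 where 2: "v \<le> (j + 1) * (t + 1)" "Q R2 M2"
        "runs w p (Ram_State l R1 M1) v (Ram_State (l + csize (RepeatUntil c a)) R2 M2)"
        using less.IH[OF j f] by blast
      have "(j + 1) * (t + 1) \<le> i * (t + 1)" using j by (intro mult_right_mono) auto
      then have "u + 1 + v \<le> (i + 1) * (t + 1)" using 1(1) 2(1) by simp
      then show ?thesis using runs_trans[OF s, of v] True 2(2,3) by auto
    next
      case False
      then show ?thesis using s 1(1,2) by (intro exI[of _ "u + 1"]) auto
    qed
  qed
qed

text \<open>Stands in for multiplication by \<open>2 ^ j\<close>. Partial results never exceed the
  final one, so a single bound covers the whole block.\<close>

lemma wp_double:
  assumes "R t * 2 ^ j < 2 ^ w" "Q (R(t := R t * 2 ^ j)) M"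
  shows "wp w (replicate j (AddI t t t)) Q R M"
  using assms
proof (induction j arbitrary: R)
  case (Suc j)
  let ?R = "R(t := R t + R t)"
  have eq: "?R t * 2 ^ j = R t * 2 ^ Suc j" by (simp add: algebra_simps)
  have "R t * 2 \<le> R t * 2 ^ Suc j" by (intro mult_left_mono) auto
  then have "R t + R t \<le> R t * 2 ^ Suc j" by linarith
  moreover have "wp w (replicate j (AddI t t t)) Q ?R M"
    using Suc.prems by (intro Suc.IH) (simp_all only: eq fun_upd_upd not_False_eq_True)
  ultimately show ?case using Suc.prems(1) by (simp del: fun_upd_apply power_Suc)
qed simp

lemma wp_mult:
  assumes "a \<noteq> b" "R a + j * R b < 2 ^ w" "Q (R(a := R a + j * R b)) M"
  shows "wp w (replicate j (AddI a a b)) Q R M"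
  using assms
proof (induction j arbitrary: R)
  case (Suc j)
  let ?R = "R(a := R a + R b)"
  have eq: "?R a + j * ?R b = R a + Suc j * R b" using Suc.prems(1) by simp
  have "wp w (replicate j (AddI a a b)) Q ?R M"
    using Suc.prems by (intro Suc.IH) (simp_all only: eq fun_upd_upd not_False_eq_True)
  then show ?case using Suc.prems(2) by (simp del: fun_upd_apply)
qed simp

text \<open>Emits constants as straight-line code. With \<open>r\<close> and \<open>h\<close> fixed,
  the base table accounts for constantly many instructions.\<close>

fun write_words :: "nat \<Rightarrow> nat \<Rightarrow> nat \<Rightarrow> nat list \<Rightarrow> instr list" where
  "write_words q d e [] = []"
| "write_words q d e (v # vs) = ConstI d v # StoreI q d # AddI q q e # write_words q d e vs"

lemma wp_write_words:
  assumes "\<And>v. v \<in> set vs \<Longrightarrow> v < 2 ^ w" "q \<noteq> d" "e \<noteq> q" "e \<noteq> d" "R e = 1" "R q + length vs < 2 ^ w"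
    "\<And>R' M'. (\<And>x. x \<noteq> q \<Longrightarrow> x \<noteq> d \<Longrightarrow> R' x = R x) \<Longrightarrow> R' q = R q + length vs \<Longrightarrow>
       (\<And>i. i < length vs \<Longrightarrow> M' (R q + i) = vs ! i) \<Longrightarrow> (\<And>j. j < R q \<Longrightarrow> M' j = M j) \<Longrightarrow> Q R' M'"
  shows "wp w (write_words q d e vs) Q R M"
  using assms
proof (induction vs arbitrary: R M)
  case (Cons v vs)
  let ?R = "R(d := v, q := Suc (R q))" and ?M = "M(R q := v)"
  have "wp w (write_words q d e vs) Q ?R ?M"
  proof (rule Cons.IH)
    fix R' M'
    assume a: "\<And>x. x \<noteq> q \<Longrightarrow> x \<noteq> d \<Longrightarrow> R' x = ?R x" "R' q = ?R q + length vs"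
      "\<And>i. i < length vs \<Longrightarrow> M' (?R q + i) = vs ! i" "\<And>j. j < ?R q \<Longrightarrow> M' j = ?M j"
    show "Q R' M'"
    proof (rule Cons.prems(7))
      fix i assume "i < length (v # vs)"
      then show "M' (R q + i) = (v # vs) ! i"
        using a(3)[of "i - 1"] a(4)[of "R q"] by (cases i) auto
    qed (use a Cons.prems in auto)
  qed (use Cons.prems in auto)
  then show ?case using Cons.prems by (simp add: fun_upd_twist)
qed simp

lemma length_write_words [simp]: "length (write_words q d e vs) = 3 * length vs"
  by (induction vs) auto

section \<open>Cascades of transducers\<close>

text \<open>The state just before cell \<open>p\<close> is read. Starting from 0 acts like zeros to
  the left of the row; the positions that this falsifies are the ones excluded in
  \<open>ca_pow_eq\<close>.\<close>

primrec tstate :: "(nat \<Rightarrow> nat \<Rightarrow> nat) \<Rightarrow> (nat \<Rightarrow> nat) \<Rightarrow> nat \<Rightarrow> nat" where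
  "tstate f x 0 = 0"
| "tstate f x (Suc p) = f (tstate f x p) (x p)"

definition tout :: "(nat \<Rightarrow> nat \<Rightarrow> nat) \<Rightarrow> (nat \<Rightarrow> nat \<Rightarrow> nat) \<Rightarrow> (nat \<Rightarrow> nat) \<Rightarrow> nat \<Rightarrow> nat" where
  "tout f g x p = g (tstate f x p) (x p)"

context
  fixes r :: nat and h :: "bool list \<Rightarrow> bool"
begin

definition nstates :: nat where "nstates = 2 ^ (2 * r + 1)"

lemma nstates_ge_2: "2 \<le> nstates"
  by (simp add: nstates_def)

lemma nstates_pos [simp]: "0 < nstates"
  using nstates_ge_2 by simp

text \<open>A shift register with the newest cell in bit 0.\<close>

definition nxt1 :: "nat \<Rightarrow> nat \<Rightarrow> nat" where
  "nxt1 s b = (2 * s + b) mod nstates"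

text \<open>The oldest of the \<open>2 * r + 1\<close> bits is the leftmost cell of the
  neighbourhood, so the list runs down from bit \<open>2 * r\<close>.\<close>

definition out1 :: "nat \<Rightarrow> nat \<Rightarrow> nat" where
  "out1 s b = of_bool (h (map (\<lambda>j. bit (2 * s + b) (2 * r - j)) [0..<2 * r + 1]))"

text \<open>A state of the cascade is a number with \<open>k\<close> digits in base
  \<open>nstates\<close>. The least significant digit belongs to the last copy, which reads what the
  other copies output in the same step.\<close>

fun out :: "nat \<Rightarrow> nat \<Rightarrow> nat \<Rightarrow> nat" where
  "out 0 s b = b"
| "out (Suc k) s b = out1 (s mod nstates) (out k (s div nstates) b)"

fun nxt :: "nat \<Rightarrow> nat \<Rightarrow> nat \<Rightarrow> nat" where
  "nxt 0 s b = 0"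
| "nxt (Suc k) s b = nxt k (s div nstates) b * nstates + nxt1 (s mod nstates) (out k (s div nstates) b)"

declare nxt.simps(2) [simp del] out.simps(2) [simp del]

lemma nxt1_less: "nxt1 s b < nstates"
  by (simp add: nxt1_def)

lemma out1_le: "out1 s b \<le> 1"
  by (simp add: out1_def)

lemma out_le: "b \<le> 1 \<Longrightarrow> out k s b \<le> 1"
  by (induction k arbitrary: s) (auto simp: out1_le out.simps(2) simp del: One_nat_def)

lemma nxt_less: "nxt k s b < nstates ^ k"
proof (induction k arbitrary: s)
  case (Suc k)
  have "Suc (nxt k (s div nstates) b) * nstates \<le> nstates ^ k * nstates"
    using Suc[of "s div nstates"] by (intro mult_right_mono) auto
  then show ?case using nxt1_less[of "s mod nstates" "out k (s div nstates) b"] by (simp add: nxt.simps(2) algebra_simps)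
qed simp

lemma nxt_1: "s < nstates \<Longrightarrow> nxt (Suc 0) s b = nxt1 s b"
  and out_1: "s < nstates \<Longrightarrow> out (Suc 0) s b = out1 s b"
  by (simp_all add: nxt.simps(2) out.simps(2))

lemma nxt_Suc_pair: "s' < nstates \<Longrightarrow> nxt (Suc k) (s * nstates + s') b = nxt k s b * nstates + nxt1 s' (out k s b)"
  and out_Suc_pair: "s' < nstates \<Longrightarrow> out (Suc k) (s * nstates + s') b = out1 s' (out k s b)"
  by (simp_all add: nxt.simps(2) out.simps(2))

lemma tstate_nxt1_less: "tstate nxt1 y p < nstates"
  by (cases p) (simp_all add: nxt1_less)

abbreviation ca :: "(nat \<Rightarrow> nat) \<Rightarrow> nat \<Rightarrow> nat" where
  "ca \<equiv> tout nxt1 out1"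

text \<open>Splitting off the lowest digit commutes with reading a cell: by
  \<open>nxt_Suc_pair\<close> the upper digits evolve on their own, and the lowest one is a single
  copy fed with their output.\<close>

lemma tstate_nxt_Suc:
  "tstate (nxt (Suc k)) x p = tstate (nxt k) x p * nstates + tstate nxt1 (tout (nxt k) (out k) x) p"
  by (induction p) (simp_all add: nxt_Suc_pair tstate_nxt1_less, simp add: tout_def)

lemma tout_cascade: "tout (nxt k) (out k) x = (ca ^^ k) x"
proof (induction k)
  case (Suc k)
  have "tout (nxt (Suc k)) (out (Suc k)) x p = ca (tout (nxt k) (out k) x) p" for p
    by (simp add: tout_def[of "nxt (Suc k)"] tout_def[of nxt1] tstate_nxt_Suc out_Suc_pair
        tstate_nxt1_less) (simp add: tout_def)
  then show ?case using Suc by (auto intro!: ext)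
qed (auto simp: tout_def)

lemma ca_le: "x p \<le> 1 \<Longrightarrow> (ca ^^ k) x p \<le> 1"
  using out_le unfolding tout_cascade[symmetric] tout_def by blast

section \<open>What the cascade computes in terms of the automaton\<close>

lemma bit_nxt1:
  assumes "b \<le> 1" "i < 2 * r + 1"
  shows "bit (2 * s + b) i \<longleftrightarrow> (if i = 0 then b = 1 else bit s (i - 1))"
    "bit (nxt1 s b) i \<longleftrightarrow> (if i = 0 then b = 1 else bit s (i - 1))"
proof -
  have b: "b = 0 \<or> b = 1" using assms(1) by auto
  then show 1: "bit (2 * s + b) i \<longleftrightarrow> (if i = 0 then b = 1 else bit s (i - 1))"
    by (cases i) (auto simp: bit_0 bit_Suc)
  have "nxt1 s b = take_bit (2 * r + 1) (2 * s + b)"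
    by (simp add: nxt1_def nstates_def take_bit_eq_mod)
  then show "bit (nxt1 s b) i \<longleftrightarrow> (if i = 0 then b = 1 else bit s (i - 1))"
    using 1 assms(2) by (simp add: bit_take_bit_iff)
qed

lemma bit_tstate:
  assumes "\<And>p. x p \<le> 1" "i < 2 * r + 1" "i < p"
  shows "bit (tstate nxt1 x p) i \<longleftrightarrow> x (p - 1 - i) = 1"
  using assms(2,3)
proof (induction p arbitrary: i)
  case (Suc p)
  then show ?case
    using bit_nxt1(2)[OF assms(1)[of p], of i "tstate nxt1 x p"] Suc.IH[of "i - 1"] by auto
qed simp

text \<open>The window of cell \<open>p\<close> ends at \<open>p\<close> instead of being centred there, so that a row can be
  overwritten from left to right; hence the shift by \<open>r\<close> cells per generation.\<close>

lemma ca_eq: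
  assumes "\<And>p. x p \<le> 1" "2 * r \<le> p"
  shows "ca x p = of_bool (h (map (\<lambda>j. x (p - 2 * r + j) = 1) [0..<2 * r + 1]))"
proof -
  have "bit (2 * tstate nxt1 x p + x p) (2 * r - j) \<longleftrightarrow> x (p - 2 * r + j) = 1"
    if j: "j < 2 * r + 1" for j
  proof -
    note 1 = bit_nxt1(1)[OF assms(1)[of p], of "2 * r - j" "tstate nxt1 x p"]
    show ?thesis
    \<comment> \<open>The newest bit is the cell being read, which has not entered the state yet;
      the other bits come from the state.\<close>
    proof (cases "j = 2 * r")
      case True
      then show ?thesis using 1 assms(2) by (simp only: le_add_diff_inverse2) simp
    next
      case False
      then have "p - 1 - (2 * r - j - 1) = p - 2 * r + j" using j assms(2) by simp
      then show ?thesis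
        using 1 False j assms(2) bit_tstate[OF assms(1), of "2 * r - j - 1" p] by simp
    qed
  qed
  then show ?thesis
    unfolding tout_def out1_def by (intro arg_cong[where f = "\<lambda>l. of_bool (h l)"] map_cong) auto
qed

text \<open>Each generation shifts the meaning of position \<open>p\<close> by another
  \<open>r\<close> cells and spoils \<open>2 * r\<close> further positions on the left, where the
  start state replaces missing cells. Nothing is lost on the right, because windows extend only to
  the left. Here \<open>c\<close> is the coordinate of position 0 in the original row.\<close>

lemma ca_pow_eq:
  assumes "\<And>p. x p \<le> 1" "\<And>p. p < L \<Longrightarrow> x p = of_bool (X (c + int p))"
    "2 * r * k \<le> p" "p < L"
  shows "(ca ^^ k) x p = of_bool ((global_update r h ^^ k) X (c + int p - int (r * k)))"
  using assms(3,4)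
proof (induction k arbitrary: p)
  case 0
  then show ?case using assms(2) by simp
next
  case (Suc k)
  let ?y = "(ca ^^ k) x" and ?Y = "(global_update r h ^^ k) X"
  have "?y (p - 2 * r + j) = 1 \<longleftrightarrow> ?Y (c + int p - int (r * Suc k) - int r + int j)"
    if "j < 2 * r + 1" for j
  proof -
    have "?y (p - 2 * r + j) = of_bool (?Y (c + int (p - 2 * r + j) - int (r * k)))"
      using Suc.prems that by (intro Suc.IH) (auto simp: algebra_simps)
    moreover have "c + int (p - 2 * r + j) - int (r * k) = c + int p - int (r * Suc k) - int r + int j"
      using Suc.prems by (simp add: of_nat_diff algebra_simps)
    ultimately show ?thesis by (simp only: of_bool_eq_1_iff)
  qed
  then have l: "map (\<lambda>j. ?y (p - 2 * r + j) = 1) [0..<2 * r + 1] =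
      neighbourhood r ?Y (c + int p - int (r * Suc k))"
    unfolding neighbourhood_def by (intro map_cong) auto
  have "ca ?y p = of_bool (h (neighbourhood r ?Y (c + int p - int (r * Suc k))))"
    unfolding l[symmetric] using Suc.prems(1) ca_le assms(1) by (intro ca_eq) auto
  then show ?case by (simp only: funpow.simps comp_apply global_update_def[of r h ?Y])
qed

end

section \<open>Asymptotics\<close>

text \<open>The level at which the table construction stops. The minimum 2 reflects that a
  repeat-until loop runs at least once and starts from level 1.\<close>

definition num_levels :: "nat \<Rightarrow> nat \<Rightarrow> nat" where
  "num_levels b n = (LEAST K. 2 \<le> K \<and> n < 4 * b ^ K)"

lemma eventually_le_imp_bigo:
  fixes f :: "nat \<Rightarrow> nat" and g :: "nat \<Rightarrow> real"
  assumes "eventually (\<lambda>n. real (f n) \<le> g n) sequentially"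
  shows "(\<lambda>n. real (f n)) \<in> O(g)"
  using assms by (intro bigoI[where c = 1]) (auto elim: eventually_mono)

lemma num_levels:
  assumes "2 \<le> b"
  shows "2 \<le> num_levels b n" "n < 4 * b ^ num_levels b n"
    "2 \<le> k \<Longrightarrow> k < num_levels b n \<Longrightarrow> 4 * b ^ k \<le> n"
    "1 \<le> n \<Longrightarrow> b ^ num_levels b n \<le> b\<^sup>2 * n"
proof -
  let ?P = "\<lambda>K. 2 \<le> K \<and> n < 4 * b ^ K"
  have "n + 2 < b ^ (n + 2)"
    using less_exp[of "n + 2"] power_mono[OF assms, of "n + 2"] by linarith
  then have "?P (n + 2)" by linarith
  then have P: "?P (num_levels b n)" unfolding num_levels_def by (rule LeastI)
  then show "2 \<le> num_levels b n" "n < 4 * b ^ num_levels b n" by auto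
  show least: "4 * b ^ k \<le> n" if "2 \<le> k" "k < num_levels b n" for k
    using not_less_Least[of k ?P] that unfolding num_levels_def by auto
  show "b ^ num_levels b n \<le> b\<^sup>2 * n" if "1 \<le> n"
  \<comment> \<open>At level 2 there is no smaller admissible level to compare with, and
    \<open>1 <= n\<close> suffices.\<close>
  proof (cases "num_levels b n = 2")
    case True
    then show ?thesis using that by simp
  next
    case False
    then obtain k where k: "num_levels b n = Suc k" "2 \<le> k"
      using P by (cases "num_levels b n") auto
    have "b * b ^ k \<le> b * n" using least[of k] k by (intro mult_left_mono) auto
    also have "b * n \<le> b\<^sup>2 * n" using assms by (simp add: power2_eq_square)
    finally show ?thesis using k by simp
  qed
qed

lemma num_levels_asymp:
  assumes "2 \<le> b"
  shows "(\<lambda>n. real (b ^ num_levels b n)) \<in> O(\<lambda>n. real n)"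
    "(\<lambda>n. real (num_levels b n)) \<in> O(\<lambda>n. ln (real n))"
    "(\<lambda>n. real ((n - 1) div num_levels b n)) \<in> O(\<lambda>n. real n / ln (real n))"
proof -
  let ?K = "num_levels b"
  have b: "0 < ln (real b)" using assms by simp
  have pow: "real (b ^ ?K n) \<le> real (b\<^sup>2) * real n" if "1 \<le> n" for n
    using num_levels(4)[OF assms that] by (simp only: of_nat_mult[symmetric] of_nat_le_iff)
  show "(\<lambda>n. real (b ^ ?K n)) \<in> O(\<lambda>n. real n)"
    by (rule bigoI[where c = "real (b\<^sup>2)"], rule eventually_sequentiallyI[of 1])
      (use pow in simp)
  have upper: "real (?K n) \<le> 2 + ln (real n) / ln (real b)" if "1 \<le> n" for n
  proof -
    have "real (?K n) * ln (real b) = ln (real (b ^ ?K n))"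
      using assms by (simp add: ln_realpow)
    also have "\<dots> \<le> ln (real (b\<^sup>2) * real n)"
      using pow[OF that] assms by (subst ln_le_cancel_iff) (use that in auto)
    also have "\<dots> = 2 * ln (real b) + ln (real n)"
      using assms that by (simp add: ln_mult ln_realpow)
    finally show ?thesis using b by (simp add: field_simps)
  qed
  have "(\<lambda>n. real (?K n)) \<in> O(\<lambda>n. 2 + ln (real n) / ln (real b))"
    by (rule eventually_le_imp_bigo, rule eventually_sequentiallyI[of 1], fact upper)
  also have "(\<lambda>n. 2 + ln (real n) / ln (real b)) \<in> O(\<lambda>n. ln (real n))"
    using b by real_asymp
  finally show "(\<lambda>n. real (?K n)) \<in> O(\<lambda>n. ln (real n))" .
  have lower: "ln (real n) - ln 4 \<le> real (?K n) * ln (real b)" if "1 \<le> n" for n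
  proof -
    have "real n \<le> 4 * real b ^ ?K n"
      using num_levels(2)[OF assms, of n] by (metis of_nat_le_iff of_nat_mult of_nat_numeral of_nat_power less_imp_le)
    then have "ln (real n) \<le> ln (4 * real b ^ ?K n)"
      using that assms by (subst ln_le_cancel_iff) auto
    then show ?thesis using assms by (simp add: ln_mult ln_realpow)
  qed
  \<comment> \<open>The bound that follows divides by \<open>ln n - ln 4\<close>, which is positive
    only from \<open>n = 5\<close> on.\<close>
  have "eventually (\<lambda>n. 0 < ln (real n) - ln 4) sequentially" by real_asymp
  then have "eventually (\<lambda>n. real ((n - 1) div ?K n) \<le> ln (real b) * (real n / (ln (real n) - ln 4))) sequentially"
    using eventually_ge_at_top[of 1]
  proof eventually_elim
    case (elim n)
    have "real ((n - 1) div ?K n) * real (?K n) \<le> real n"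
      by (metis div_times_less_eq_dividend of_nat_le_iff of_nat_mult diff_le_self le_trans)
    have "real ((n - 1) div ?K n) * (ln (real n) - ln 4) \<le> real ((n - 1) div ?K n) * (real (?K n) * ln (real b))"
      using lower elim by (intro mult_left_mono) auto
    also have "\<dots> \<le> real n * ln (real b)"
      using \<open>_ \<le> real n\<close> b by (simp add: mult.assoc[symmetric])
    finally show ?case using elim by (simp add: field_simps)
  qed
  then have "(\<lambda>n. real ((n - 1) div ?K n)) \<in> O(\<lambda>n. ln (real b) * (real n / (ln (real n) - ln 4)))"
    by (rule eventually_le_imp_bigo)
  also have "(\<lambda>n. ln (real b) * (real n / (ln (real n) - ln 4))) \<in> O(\<lambda>n. real n / ln (real n))"
    by real_asymp
  finally show "(\<lambda>n. real ((n - 1) div ?K n)) \<in> O(\<lambda>n. real n / ln (real n))" .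
qed

text \<open>If the least exponent is \<open>Suc v\<close>, then minimality gives
  \<open>2 ^ v < Z n\<close>, so it exceeds the binary logarithm of a linear function by at most
  1.\<close>

lemma Least_power_asymp:
  assumes "(\<lambda>n. real (Z n)) \<in> O(\<lambda>n. real n)"
  shows "(\<lambda>n. real (LEAST w. Z n \<le> 2 ^ w)) \<in> O(\<lambda>n. ln (real n))"
proof -
  obtain C where C: "0 < C" "eventually (\<lambda>n. real (Z n) \<le> C * real n) sequentially"
    using assms by (elim landau_o.bigE) auto
  have "eventually (\<lambda>n. 0 \<le> (ln C + ln (real n)) / ln 2 + 1) sequentially"
    by real_asymp
  with C(2) have "eventually (\<lambda>n. real (LEAST w. Z n \<le> 2 ^ w) \<le> (ln C + ln (real n)) / ln 2 + 1) sequentially"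
    using eventually_ge_at_top[of 1]
  proof eventually_elim
    case (elim n)
    show ?case
    proof (cases "LEAST w. Z n \<le> 2 ^ w")
      case 0
      then show ?thesis using elim by simp
    next
      case (Suc v)
      then have "\<not> Z n \<le> 2 ^ v" using not_less_Least[of v "\<lambda>w. Z n \<le> 2 ^ w"] by simp
      then have "(2::real) ^ v \<le> real (Z n)"
        by (metis linear of_nat_le_iff of_nat_numeral of_nat_power)
      then have "(2::real) ^ v \<le> C * real n" using elim by linarith
      then have "ln (2 ^ v) \<le> ln (C * real n)"
        using elim C(1) by (subst ln_le_cancel_iff) simp_all
      then have "real v * ln 2 \<le> ln C + ln (real n)"
        using C(1) elim by (simp add: ln_realpow ln_mult)
      then show ?thesis using Suc by (simp add: field_simps)
    qed
  qed
  then have "(\<lambda>n. real (LEAST w. Z n \<le> 2 ^ w)) \<in> O(\<lambda>n. (ln C + ln (real n)) / ln 2 + 1)"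
    by (rule eventually_le_imp_bigo)
  also have "(\<lambda>n. (ln C + ln (real n)) / ln 2 + 1) \<in> O(\<lambda>n. ln (real n))"
    by real_asymp
  finally show ?thesis .
qed

section \<open>The program\<close>

abbreviation (input) "r_n \<equiv> 0 :: nat"
abbreviation (input) "r_m \<equiv> 1 :: nat"
abbreviation (input) "r_one \<equiv> 2 :: nat"
abbreviation (input) "r_two \<equiv> 3 :: nat"
abbreviation (input) "r_four \<equiv> 4 :: nat"
abbreviation (input) "r_gens \<equiv> 5 :: nat"
abbreviation (input) "r_row \<equiv> 6 :: nat"
abbreviation (input) "r_end \<equiv> 7 :: nat"
abbreviation (input) "r_result \<equiv> 8 :: nat"
abbreviation (input) "r_base \<equiv> 9 :: nat"
abbreviation (input) "r_size \<equiv> 10 :: nat"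
abbreviation (input) "r_k \<equiv> 11 :: nat"
abbreviation (input) "r_exit \<equiv> 12 :: nat"
abbreviation (input) "r_src \<equiv> 13 :: nat"
abbreviation (input) "r_src1 \<equiv> 14 :: nat"
abbreviation (input) "r_dst \<equiv> 15 :: nat"
abbreviation (input) "r_addr \<equiv> 16 :: nat"
abbreviation (input) "r_bit \<equiv> 17 :: nat"
abbreviation (input) "r_st \<equiv> 18 :: nat"
abbreviation (input) "r_st1 \<equiv> 19 :: nat"
abbreviation (input) "r_out \<equiv> 20 :: nat"
abbreviation (input) "r_next \<equiv> 21 :: nat"
abbreviation (input) "r_cell \<equiv> 22 :: nat"

definition copy :: "nat \<Rightarrow> nat \<Rightarrow> instr list" where
  "copy a b = [ConstI a 0, AddI a a b]"

text \<open>Offset \<open>e\<close> addresses the state \<open>e div 4\<close> and its slot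
  \<open>e mod 4\<close>, in the layout described by \<open>is_record\<close>.\<close>

definition table_words :: "nat \<Rightarrow> (bool list \<Rightarrow> bool) \<Rightarrow> nat list" where
  "table_words r h = map (\<lambda>e. if e mod 4 < 2 then 4 * nxt1 r (e div 4) (e mod 4)
     else out1 r h (e div 4) (e mod 4 - 2)) [0..<4 * nstates r]"

text \<open>Two registers serve twice: \<open>r_result\<close> is the total number of spoiled cells
  and hence the address of the output, and \<open>r_row\<close> is the length of the row with its
  junk cell and hence the address of the base table.\<close>

definition prepare :: "nat \<Rightarrow> (bool list \<Rightarrow> bool) \<Rightarrow> com" where
  "prepare r h = Block ([ConstI r_one 1, ConstI r_two 2, ConstI r_four 4, SubI r_gens r_n r_one,
     ConstI r_result 0] @ replicate (2 * r) (AddI r_result r_result r_gens) @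
     [AddI r_row r_result r_m, AddI r_row r_row r_one] @ copy r_dst r_row @
     write_words r_dst r_out r_one (table_words r h) @
     copy r_base r_row @ copy r_end r_dst @ [ConstI r_size (4 * nstates r), ConstI r_k 1])"

text \<open>Both successors carry the factor 4, so shifting one by \<open>2 * r + 1\<close> bits,
  which multiplies it by \<open>nstates\<close>, and adding the other gives 4 times the paired
  state.\<close>

definition compose_entry :: "nat \<Rightarrow> instr list" where
  "compose_entry r = [LoadI r_st r_src, AddI r_addr r_src r_two, LoadI r_bit r_addr,
     AddI r_addr r_src1 r_bit, LoadI r_st1 r_addr, AddI r_addr r_addr r_two, LoadI r_out r_addr] @
     replicate (2 * r + 1) (AddI r_st r_st r_st) @
     [AddI r_st r_st r_st1, StoreI r_dst r_st, AddI r_addr r_dst r_two, StoreI r_addr r_out]"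

definition compose_record :: "nat \<Rightarrow> com" where
  "compose_record r = Block (compose_entry r @ [AddI r_src r_src r_one, AddI r_dst r_dst r_one] @
     compose_entry r @ [SubI r_src r_src r_one, AddI r_dst r_dst r_two, AddI r_dst r_dst r_one,
     AddI r_src1 r_src1 r_four, AddI r_exit r_src1 r_one, SubI r_exit r_exit r_end])"

text \<open>With the old state \<open>s\<close> fixed and the base state \<open>s'\<close> running
  innermost, the index \<open>s * nstates + s'\<close> grows by one at a time. The new table is thus
  written sequentially and no index is ever computed.\<close>

definition compose_row :: "nat \<Rightarrow> com" where
  "compose_row r = Block (copy r_src1 r_row) ;; RepeatUntil (compose_record r) r_exit ;;
     Block [AddI r_src r_src r_four, AddI r_exit r_src r_one, SubI r_exit r_exit r_next]"

definition compose_table :: "nat \<Rightarrow> com" where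
  "compose_table r = Block (AddI r_next r_base r_size # copy r_dst r_next @ copy r_src r_base) ;;
     RepeatUntil (compose_row r) r_exit ;;
     Block (copy r_base r_next @ replicate (2 * r + 1) (AddI r_size r_size r_size) @
       [AddI r_k r_k r_one, SubI r_exit r_size r_n])"

text \<open>Subtraction is truncated, so \<open>r_exit\<close>, set to \<open>i + 1 - e\<close>, is nonzero iff \<open>i \<ge> e\<close>.\<close>

definition update_cell :: com where
  "update_cell = Block [LoadI r_bit r_cell, AddI r_addr r_st r_base, AddI r_addr r_addr r_bit,
     LoadI r_st r_addr, AddI r_addr r_addr r_two, LoadI r_out r_addr, StoreI r_cell r_out,
     AddI r_cell r_cell r_one, AddI r_exit r_cell r_one, SubI r_exit r_exit r_row]"

definition update_row :: com where
  "update_row = Block [ConstI r_cell 0, ConstI r_st 0] ;; RepeatUntil update_cell r_exit"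

text \<open>The outer test handles \<open>n = 1\<close>, as a repeat-until loop would perform a pass
  regardless. When fewer than \<open>k\<close> generations remain, the base table takes over; it
  stays in force because then \<open>k = 1\<close>.\<close>

definition main_loop :: com where
  "main_loop = IfNZ r_gens (RepeatUntil (Block [SubI r_exit r_k r_gens] ;;
     IfNZ r_exit (Block (ConstI r_k 1 # copy r_base r_row)) ;;
     Block [SubI r_gens r_gens r_k] ;; update_row ;; Block [SubI r_exit r_one r_gens]) r_exit)"

definition program :: "nat \<Rightarrow> (bool list \<Rightarrow> bool) \<Rightarrow> com" where
  "program r h = prepare r h ;; RepeatUntil (compose_table r) r_exit ;; main_loop ;;
     Block (copy r_n r_result)"

section \<open>Correctness\<close>

text \<open>The successor rules would rewrite address offsets such as \<open>b + 2\<close>.\<close>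

declare fun_upd_apply [simp del] fun_upd_same [simp] fun_upd_other [simp]
  replicate.simps(2) [simp del] add_2_eq_Suc [simp del] add_2_eq_Suc' [simp del]
  add_Suc_right [simp del] add_Suc [simp del]

text \<open>The four words of a state: the successors under the inputs 0 and 1, then the two outputs.
  A successor is stored as its offset in the table, hence the factor 4.\<close>

definition is_record :: "nat \<Rightarrow> (bool list \<Rightarrow> bool) \<Rightarrow> (nat \<Rightarrow> nat) \<Rightarrow> nat \<Rightarrow> nat \<Rightarrow> nat \<Rightarrow> bool" where
  "is_record r h M b k s \<longleftrightarrow> (\<forall>c\<le>1. M (b + 4 * s + c) = 4 * nxt r h k s c \<and>
     M (b + 4 * s + c + 2) = out r h k s c)"

definition is_table :: "nat \<Rightarrow> (bool list \<Rightarrow> bool) \<Rightarrow> (nat \<Rightarrow> nat) \<Rightarrow> nat \<Rightarrow> nat \<Rightarrow> nat \<Rightarrow> bool" where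
  "is_table r h M b k N \<longleftrightarrow> (\<forall>s<N. is_record r h M b k s)"

lemma is_table_frame:
  assumes "is_table r h M b k N" "\<And>j. j < b + 4 * N \<Longrightarrow> M' j = M j"
  shows "is_table r h M' b k N"
  using assms unfolding is_table_def is_record_def by auto

lemma is_table_Suc:
  "is_table r h M b k N \<Longrightarrow> is_record r h M b k N \<Longrightarrow> is_table r h M b k (Suc N)"
  unfolding is_table_def by (auto simp: less_Suc_eq)

lemma is_table_D:
  assumes "is_table r h M b k N" "s < N" "c \<le> 1"
  shows "M (b + 4 * s + c) = 4 * nxt r h k s c" "M (b + 4 * s + c + 2) = out r h k s c"
  using assms unfolding is_table_def is_record_def by auto

text \<open>The row has one junk cell at its right end, so that it is never empty (the loop over it runs at
  least once). The base table follows at address \<open>D\<close>.\<close>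

locale ca_run =
  fixes r :: nat and h :: "bool list \<Rightarrow> bool" and n m K w D :: nat and x :: "nat \<Rightarrow> nat"
  assumes n: "1 \<le> n" and K: "2 \<le> K" "n < 4 * nstates r ^ K"
    and K_least: "\<And>k. 2 \<le> k \<Longrightarrow> k < K \<Longrightarrow> 4 * nstates r ^ k \<le> n"
    and D: "D = 2 * r * (n - 1) + m + 1"
    and w: "D + 8 * nstates r ^ K + n + 8 \<le> 2 ^ w"
    and x: "\<And>p. x p \<le> 1"
begin

abbreviation "b \<equiv> nstates r"
abbreviation "ent \<equiv> is_table r h"

lemma b_pow: "k \<le> K \<Longrightarrow> b ^ k \<le> b ^ K"
  by (intro power_increasing) (auto simp: Suc_le_eq)

lemma b_le: "b \<le> b ^ K"
  using b_pow[of 1] K by simp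

section \<open>Memory layout and the construction of the tables\<close>

definition core :: "(nat \<Rightarrow> nat) \<Rightarrow> asn" where
  "core y R M \<longleftrightarrow> R r_n = n \<and> R r_one = 1 \<and> R r_two = 2 \<and> R r_four = 4 \<and> R r_row = D \<and>
     R r_end = D + 4 * b \<and> R r_result = 2 * r * (n - 1) \<and>
     (\<forall>p<D. M p = y p) \<and> ent M D 1 b"

text \<open>The tables of lower levels occupy \<open>4 * (b + ... + b ^ (k - 1))\<close> words, at
  most \<open>4 * b ^ k\<close> since \<open>b >= 2\<close>; this is the bound on \<open>a\<close>.
  The table at level \<open>K\<close> then ends by \<open>D + 8 * b ^ K\<close>, which is the origin
  of the 8 in the assumption on \<open>w\<close>.\<close>

definition tabled :: "nat \<Rightarrow> nat \<Rightarrow> asn" where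
  "tabled k a R M \<longleftrightarrow> core x R M \<and> R r_gens = n - 1 \<and> R r_k = k \<and> R r_base = a \<and>
     R r_size = 4 * b ^ k \<and> ent M a k (b ^ k) \<and> 1 \<le> k \<and> D \<le> a \<and> a \<le> D + 4 * b ^ k"

lemma wp_compose_entry:
  assumes "core x R M" "ent M a k (b ^ k)" "s < b ^ k" "s' < b" "c \<le> 1" "k < K"
    "R r_src = a + 4 * s + c" "R r_src1 = D + 4 * s'" "a \<le> D + 4 * b ^ k"
    "R r_dst + 2 < 2 ^ w"
    "\<And>R'. (\<And>y. y \<notin> {r_addr, r_bit, r_st, r_st1, r_out} \<Longrightarrow> R' y = R y) \<Longrightarrow>
      Q R' (M(R r_dst := 4 * nxt r h (Suc k) (s * b + s') c,
              R r_dst + 2 := out r h (Suc k) (s * b + s') c))"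
  shows "wp w (compose_entry r) Q R M"
proof -
  let ?o = "out r h k s c"
  have o: "?o \<le> 1" using out_le assms(5) by blast
  have c1: "R r_two = 2" and t1: "ent M D 1 b" using assms(1) by (auto simp: core_def)
  have v: "M (a + 4 * s + c) = 4 * nxt r h k s c" "M (a + 4 * s + c + 2) = ?o"
    using is_table_D[OF assms(2,3,5)] by auto
  have v': "M (D + 4 * s' + ?o) = 4 * nxt1 r s' ?o" "M (D + 4 * s' + ?o + 2) = out1 r h s' ?o"
    using is_table_D[OF t1 assms(4) o] nxt_1[OF assms(4)] out_1[OF assms(4)] by auto
  have e: "4 * nxt r h k s c * 2 ^ (2 * r + 1) + 4 * nxt1 r s' ?o = 4 * nxt r h (Suc k) (s * b + s') c"
    "out1 r h s' ?o = out r h (Suc k) (s * b + s') c"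
    using nxt_Suc_pair[OF assms(4)] out_Suc_pair[OF assms(4)]
    by (auto simp: nstates_def algebra_simps simp del: One_nat_def)
  have l: "nxt r h (Suc k) (s * b + s') c < b ^ K"
    using nxt_less[of r h "Suc k" "s * b + s'" c] b_pow[of "Suc k"] assms(6) by linarith
  have k: "b ^ k \<le> b ^ K" using b_pow assms(6) by simp
  have "4 * nxt r h k s c * 2 ^ (2 * r + 1) < 2 ^ w" using e(1) l w by linarith
  moreover have "a + 4 * s + c + 2 < 2 ^ w" using assms(3,5,9) k w by linarith
  moreover have "D + 4 * s' + ?o + 2 < 2 ^ w" using assms(4) o b_le w by linarith
  moreover have "4 * nxt r h k s c * 2 ^ (2 * r + 1) + 4 * nxt1 r s' ?o < 2 ^ w"
    using e(1) l w by linarith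
  ultimately show ?thesis
    unfolding compose_entry_def wp_append
    using assms(7,8,10) c1
    by (simp add: v v') (rule wp_double, use e in simp, use e in \<open>simp, intro assms(11), simp\<close>)
qed

lemma core_frame:
  assumes "core y R M" "\<And>j. j < D + 4 * b \<Longrightarrow> M' j = M j"
    "\<And>q. q \<in> {r_n, r_one, r_two, r_four, r_row, r_end, r_result} \<Longrightarrow> R' q = R q"
  shows "core y R' M'"
  using assms is_table_frame[of r h M D 1 b M'] by (auto simp: core_def)

text \<open>Registers are numbered so that all those mentioned in \<open>tabled\<close> lie below
  \<open>r_exit\<close>; one inequality therefore serves as the frame condition.\<close>

lemma tabled_frame:
  assumes "tabled k a R M" "\<And>j. j < a + 4 * b ^ k \<Longrightarrow> M' j = M j"
    "\<And>q. q < r_exit \<Longrightarrow> R' q = R q"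
  shows "tabled k a R' M'"
proof -
  \<comment> \<open>At level 1 the current table is the base table itself, so its end has to be
    covered as well.\<close>
  have "b \<le> b ^ k" using assms(1) power_increasing[of 1 k b] by (simp add: tabled_def Suc_le_eq)
  then have "D + 4 * b \<le> a + 4 * b ^ k" using assms(1) by (simp add: tabled_def)
  then have "core x R' M'"
    using assms by (intro core_frame[of x R M M' R']) (auto simp: tabled_def)
  moreover have "ent M' a k (b ^ k)"
    using assms by (intro is_table_frame[of r h M a k "b ^ k" M']) (auto simp: tabled_def)
  ultimately show ?thesis using assms by (simp add: tabled_def)
qed

text \<open>The number \<open>e\<close> of finished records is kept apart from \<open>s\<close>: at
  the end of a row it has already reached \<open>Suc s * b\<close> while the source pointer still
  stands at \<open>s\<close>.\<close>

definition composing :: "nat \<Rightarrow> nat \<Rightarrow> nat \<Rightarrow> nat \<Rightarrow> asn" where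
  "composing k a s e R M \<longleftrightarrow> tabled k a R M \<and> R r_next = a + 4 * b ^ k \<and> R r_src = a + 4 * s \<and>
     R r_dst = a + 4 * b ^ k + 4 * e \<and> ent M (a + 4 * b ^ k) (Suc k) e"

lemma index_less:
  assumes "s < b ^ k" "s' < b" "k < K"
  shows "s * b + s' < b ^ Suc k" "b ^ Suc k \<le> b ^ K" "b ^ k + b ^ k \<le> b ^ Suc k"
proof -
  have "Suc s * b \<le> b ^ k * b" using assms(1) by (intro mult_right_mono) auto
  then show "s * b + s' < b ^ Suc k" using assms(2) by (simp add: algebra_simps)
  show "b ^ Suc k \<le> b ^ K" using assms(3) by (intro b_pow) auto
  have "2 * b ^ k \<le> b * b ^ k" using nstates_ge_2 by (intro mult_right_mono) auto
  then show "b ^ k + b ^ k \<le> b ^ Suc k" by (simp only: power_Suc mult_2)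
qed

lemma wp_compose_record:
  assumes "composing k a s (s * b + s') R M" "R r_src1 = D + 4 * s'" "s < b ^ k" "s' < b" "k < K"
  shows "wp w (compose_entry r @ [AddI r_src r_src r_one, AddI r_dst r_dst r_one] @
     compose_entry r @ [SubI r_src r_src r_one, AddI r_dst r_dst r_two, AddI r_dst r_dst r_one,
     AddI r_src1 r_src1 r_four, AddI r_exit r_src1 r_one, SubI r_exit r_exit r_end])
     (\<lambda>R M. composing k a s (s * b + Suc s') R M \<and> R r_src1 = D + 4 * Suc s' \<and>
        (R r_exit = 0 \<longleftrightarrow> Suc s' < b)) R M"
proof -
  let ?e = "s * b + s'" and ?N = "a + 4 * b ^ k"
  note i = index_less[OF assms(3-5)]
  have t: "tabled k a R M" and regs: "R r_next = ?N" "R r_src = a + 4 * s" "R r_dst = ?N + 4 * ?e"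
    and ent0: "ent M ?N (Suc k) ?e"
    using assms(1) by (auto simp: composing_def)
  have c: "core x R M" and a: "D \<le> a" "a \<le> D + 4 * b ^ k" and tk: "ent M a k (b ^ k)"
    using t by (auto simp: tabled_def)
  have one: "R r_one = 1" "R r_two = 2" "R r_four = 4" "R r_end = D + 4 * b"
    using c by (auto simp: core_def)
  have lt: "?N + 4 * ?e + 4 < 2 ^ w"
  proof -
    \<comment> \<open>Replacing the powers of \<open>b\<close> by variables leaves a purely linear
      problem.\<close>
    have "a + 4 * P + 4 * e + 4 < W"
      if "e < S" "S \<le> T" "P + P \<le> S" "a \<le> D + 4 * P" "D + 8 * T + n + 8 \<le> W" for P e S T W
      using that by linarith
    from this[OF i a(2) w] show ?thesis .
  qed
  have lt': "a + 4 * s + 1 < 2 ^ w"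
    using lt assms(3) by linarith
  have lt'': "D + 4 * b + 4 < 2 ^ w"
    using w b_le by linarith
  have lt3: "D + 4 * s' + 5 < 2 ^ w"
    using assms(4) lt'' by linarith
  note lt = lt lt' lt'' lt3
  let ?v = "\<lambda>c. 4 * nxt r h (Suc k) ?e c" and ?o = "out r h (Suc k) ?e"
  let ?M1 = "M(R r_dst := ?v 0, R r_dst + 2 := ?o 0)"
  let ?M2 = "?M1(R r_dst + 1 := ?v 1, R r_dst + 1 + 2 := ?o 1)"
  \<comment> \<open>All four writes land in record \<open>?e\<close> of the new table, so the row,
    both source tables and the finished records survive.\<close>
  have same: "?M1 j = M j" "?M2 j = M j" if "j < ?N + 4 * ?e" for j
    using that regs by (auto simp: fun_upd_def)
  have rec: "is_record r h ?M2 ?N (Suc k) ?e"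
    unfolding is_record_def using regs(3) by (auto simp: fun_upd_def le_Suc_eq)
  have fin: "composing k a s (s * b + Suc s') R' M'"
    if "M' = ?M2" "\<And>q. q < r_exit \<Longrightarrow> R' q = R q" "R' r_next = ?N" "R' r_src = a + 4 * s"
      "R' r_dst = ?N + 4 * ?e + 4" for R' M'
  proof -
    have "ent ?M2 ?N (Suc k) (Suc ?e)"
      by (rule is_table_Suc[OF is_table_frame[OF ent0] rec]) (rule same)
    then show ?thesis
      using tabled_frame[OF t, of ?M2 R'] that same by (simp add: composing_def add_Suc_right)
  qed
  let ?Q = "\<lambda>R M. composing k a s (s * b + Suc s') R M \<and> R r_src1 = D + 4 * Suc s' \<and>
        (R r_exit = 0 \<longleftrightarrow> Suc s' < b)"
  let ?tl = "[SubI r_src r_src r_one, AddI r_dst r_dst r_two, AddI r_dst r_dst r_one,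
     AddI r_src1 r_src1 r_four, AddI r_exit r_src1 r_one, SubI r_exit r_exit r_end]"
  let ?T = "{r_addr, r_bit, r_st, r_st1, r_out}"
  have second: "wp w (compose_entry r) (wp w ?tl ?Q) (R1(r_src := R1 r_src + 1, r_dst := R1 r_dst + 1)) ?M1"
    if R1: "\<And>y. y \<notin> ?T \<Longrightarrow> R1 y = R y" for R1
  proof -
    let ?R1 = "R1(r_src := R1 r_src + 1, r_dst := R1 r_dst + 1)"
    have "tabled k a R1 ?M1"
      using R1 same(1) by (intro tabled_frame[OF t]) auto
    then have c1: "core x R1 ?M1" and tk1: "ent ?M1 a k (b ^ k)"
      by (auto simp: tabled_def)
    have c2: "core x ?R1 ?M1"
      by (rule core_frame[OF c1]) auto
    have r1: "?R1 r_dst = R r_dst + 1" "?R1 r_src = R r_src + 1" "?R1 r_src1 = R r_src1"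
      using R1 by auto
    have last: "wp w ?tl ?Q R2 ?M2" if R2: "\<And>y. y \<notin> ?T \<Longrightarrow> R2 y = ?R1 y" for R2
    proof -
      have r2: "R2 y = R y" if "y \<notin> ?T" "y \<noteq> r_src" "y \<noteq> r_dst" for y
        using R1 R2 that by auto
      have r2': "R2 r_src = a + 4 * s + 1" "R2 r_dst = ?N + 4 * ?e + 1"
        using R2[of r_src] R2[of r_dst] r1 regs by auto
      show ?thesis
        using lt by (auto simp: r2 r2' one regs assms(2) intro!: fin)
    qed
    show ?thesis
    proof (rule wp_compose_entry[OF c2 tk1 assms(3,4), where c = 1, unfolded r1])
      fix R2 assume "\<And>y. y \<notin> ?T \<Longrightarrow> R2 y = ?R1 y"
      then show "wp w ?tl ?Q R2 ?M2" by (rule last)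
    qed (use regs assms(2,5) lt a in simp_all)
  qed
  show ?thesis
    unfolding wp_append
  proof (rule wp_compose_entry[OF c tk assms(3,4), where c = 0])
    fix R1 assume R1: "\<And>y. y \<notin> ?T \<Longrightarrow> R1 y = R y"
    show "wp w [AddI r_src r_src r_one, AddI r_dst r_dst r_one]
        (wp w (compose_entry r) (wp w ?tl ?Q)) R1 ?M1"
      using second[OF R1] R1 regs one lt by simp
  qed (use regs assms lt a in auto)
qed

lemma hoare_prepare:
  "hoare w (\<lambda>R M. R r_n = n \<and> R r_m = m \<and> (\<forall>p. M p = x p)) (prepare r h)
     (20 + 2 * r + 12 * b) (tabled 1 D)"
  unfolding prepare_def
proof (rule hoare_Block)
  show "length ([ConstI r_one 1, ConstI r_two 2, ConstI r_four 4, SubI r_gens r_n r_one,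
     ConstI r_result 0] @ replicate (2 * r) (AddI r_result r_result r_gens) @
     [AddI r_row r_result r_m, AddI r_row r_row r_one] @ copy r_dst r_row @
     write_words r_dst r_out r_one (table_words r h) @
     copy r_base r_row @ copy r_end r_dst @ [ConstI r_size (4 * b), ConstI r_k 1])
     \<le> 20 + 2 * r + 12 * b"
    by (simp add: copy_def table_words_def)
next
  fix R M assume "R r_n = n \<and> R r_m = m \<and> (\<forall>p. M p = x p)"
  then have init: "R r_n = n" "R r_m = m" "\<And>p. M p = x p" by auto
  have words: "v < 2 ^ w" if "v \<in> set (table_words r h)" for v
  proof -
    have "4 * nxt1 r s c < 2 ^ w" for s c
      using nxt1_less[of r s c] w b_le by linarith
    moreover have "out1 r h s c < 2 ^ w" for s c
      using out1_le[of r h s c] w by linarith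
    ultimately show ?thesis using that by (auto simp: table_words_def)
  qed
  have len: "length (table_words r h) = 4 * b" by (simp add: table_words_def)
  have table: "ent M' D (Suc 0) b" if M': "\<And>e. e < 4 * b \<Longrightarrow> M' (D + e) = table_words r h ! e" for M'
    unfolding is_table_def is_record_def
  proof (intro allI impI)
    fix s c :: nat assume sc: "s < b" "c \<le> 1"
    then have "(4 * s + c) div 4 = s" "(4 * s + c) mod 4 = c"
      "(4 * s + (c + 2)) div 4 = s" "(4 * s + (c + 2)) mod 4 = c + 2" "4 * s + c + 2 < 4 * b"
      by auto
    then show "M' (D + 4 * s + c) = 4 * nxt r h (Suc 0) s c \<and>
        M' (D + 4 * s + c + 2) = out r h (Suc 0) s c"
      using M'[of "4 * s + c"] M'[of "4 * s + (c + 2)"] sc nxt_1[OF sc(1)] out_1[OF sc(1)]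
      by (simp add: table_words_def add.assoc)
  qed
  have lt: "D + 4 * b + 8 \<le> 2 ^ w" "2 * r * (n - 1) + m + 1 < 2 ^ w"
    "2 * r * (n - Suc 0) + m < 2 ^ w"
    using w b_le D by (simp, simp, simp)
  have fin: "tabled 1 D (R'(r_base := D, r_end := D + 4 * b, r_size := 4 * b, r_k := Suc 0)) M'"
    if "\<And>q. q \<noteq> r_dst \<Longrightarrow> q \<noteq> r_out \<Longrightarrow> R' q = (R(r_one := 1, r_two := 2, r_four := 4, r_gens := n - 1,
        r_result := 2 * r * (n - 1), r_row := D)) q"
      "\<And>e. e < 4 * b \<Longrightarrow> M' (D + e) = table_words r h ! e" "\<And>p. p < D \<Longrightarrow> M' p = M p" for R' M'
    using that table init by (auto simp: tabled_def core_def)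
  show "wp w ([ConstI r_one 1, ConstI r_two 2, ConstI r_four 4, SubI r_gens r_n r_one,
     ConstI r_result 0] @ replicate (2 * r) (AddI r_result r_result r_gens) @
     [AddI r_row r_result r_m, AddI r_row r_row r_one] @ copy r_dst r_row @
     write_words r_dst r_out r_one (table_words r h) @
     copy r_base r_row @ copy r_end r_dst @ [ConstI r_size (4 * b), ConstI r_k 1]) (tabled 1 D) R M"
    unfolding wp_append copy_def
  proof (insert lt, simp add: init init(2)[unfolded One_nat_def], rule wp_mult)
    have D': "2 * r * (n - Suc 0) + m + Suc 0 = D" by (simp add: D)
    show "wp w [AddI r_row r_result (Suc 0), AddI r_row r_row r_one]
       (wp w [ConstI r_dst 0, AddI r_dst r_dst r_row]
         (wp w (write_words r_dst r_out r_one (table_words r h))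
           (wp w [ConstI r_base 0, AddI r_base r_base r_row]
             (wp w [ConstI r_end 0, AddI r_end r_end r_dst]
               (wp w [ConstI r_size (4 * b), ConstI r_k (Suc 0)] (tabled (Suc 0) D))))))
       ((R(r_one := Suc 0, r_two := 2, r_four := 4, r_gens := n - Suc 0, r_result := 0))
         (r_result := (R(r_one := Suc 0, r_two := 2, r_four := 4, r_gens := n - Suc 0, r_result := 0)) r_result +
           2 * r * (R(r_one := Suc 0, r_two := 2, r_four := 4, r_gens := n - Suc 0, r_result := 0)) r_gens)) M"
      using lt
      apply (simp add: init(2)[unfolded One_nat_def] D')
      apply (rule wp_write_words[OF words], assumption)
      apply (simp_all add: len)
      apply (rule fin[unfolded One_nat_def]; simp)
      done
  qed (use lt in simp_all)
qed

lemma length_compose_entry: "length (compose_entry r) = 2 * r + 12"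
  by (simp add: compose_entry_def)

text \<open>A record takes two entries of \<open>2 * r + 12\<close> instructions, eight pointer
  instructions and the closing jump, which makes \<open>4 * r + 33\<close> steps.\<close>

lemma hoare_compose_row:
  assumes s: "s < b ^ k" and k: "k < K"
  shows "hoare w (composing k a s (s * b)) (compose_row r) (b * (4 * r + 33) + 5)
    (\<lambda>R M. composing k a (Suc s) (Suc s * b) R M \<and> (R r_exit = 0 \<longleftrightarrow> Suc s < b ^ k))"
proof -
  define I where "I i R M \<longleftrightarrow> (\<exists>s'<b. i = b - 1 - s' \<and> composing k a s (s * b + s') R M \<and>
    R r_src1 = D + 4 * s')" for i and R M :: "nat \<Rightarrow> nat"
  have "hoare w (I i) (compose_record r) (4 * r + 32)
      (\<lambda>R M. if R r_exit = 0 then \<exists>j<i. I j R M else composing k a s (Suc s * b) R M)" for i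
    unfolding compose_record_def
  proof (rule hoare_Block)
    fix R M assume "I i R M"
    then obtain s' where s': "s' < b" "i = b - 1 - s'" "composing k a s (s * b + s') R M"
      "R r_src1 = D + 4 * s'"
      unfolding I_def by blast
    show "wp w (compose_entry r @ [AddI r_src r_src r_one, AddI r_dst r_dst r_one] @
     compose_entry r @ [SubI r_src r_src r_one, AddI r_dst r_dst r_two, AddI r_dst r_dst r_one,
     AddI r_src1 r_src1 r_four, AddI r_exit r_src1 r_one, SubI r_exit r_exit r_end])
      (\<lambda>R M. if R r_exit = 0 then \<exists>j<i. I j R M else composing k a s (Suc s * b) R M) R M"
    proof (rule wp_mono[OF wp_compose_record[OF s'(3,4) s s'(1) k]], goal_cases)
      case (1 R M)
      show ?case
      proof (cases "Suc s' < b")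
        case True
        then have "I (b - 1 - Suc s') R M" "b - 1 - Suc s' < i"
          using 1 s' unfolding I_def by auto
        then show ?thesis using 1 True by auto
      next
        case False
        then have "s * b + Suc s' = Suc s * b" using s' by simp
        from 1[unfolded this] show ?thesis using False by auto
      qed
    qed
  qed (simp add: length_compose_entry)
  note loop = hoare_RepeatUntil[of w I, OF this, of "b - 1"]
  have "b - 1 + 1 = b" using nstates_pos[of r] by linarith
  from loop[unfolded this]
  have loop: "hoare w (I (b - 1)) (RepeatUntil (compose_record r) r_exit) (b * (4 * r + 33))
      (composing k a s (Suc s * b))"
    by (rule hoare_conseq) (simp_all add: add_Suc_right algebra_simps)
  have ba: "a + 4 * s + 5 < 2 ^ w \<and> D < 2 ^ w" if "composing k a s' e R M" for R M s' e
  proof -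
    have "a \<le> D + 4 * b ^ k" using that by (simp add: composing_def tabled_def)
    then show ?thesis using w s b_pow[of k] k by linarith
  qed
  have pre: "hoare w (composing k a s (s * b)) (Block (copy r_src1 r_row)) 2 (I (b - 1))"
  proof (rule hoare_Block)
    fix R M assume c: "composing k a s (s * b) R M"
    then have "R r_row = D" by (simp add: composing_def tabled_def core_def)
    moreover have "composing k a s (s * b) (R(r_src1 := D)) M"
      using c by (simp add: composing_def tabled_def core_def)
    ultimately show "wp w (copy r_src1 r_row) (I (b - 1)) R M"
      using ba[OF c] unfolding I_def copy_def by (auto intro!: exI[of _ 0])
  qed (simp add: copy_def)
  have post: "hoare w (composing k a s (Suc s * b))
     (Block [AddI r_src r_src r_four, AddI r_exit r_src r_one, SubI r_exit r_exit r_next]) 3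
     (\<lambda>R M. composing k a (Suc s) (Suc s * b) R M \<and> (R r_exit = 0 \<longleftrightarrow> Suc s < b ^ k))"
  proof (rule hoare_Block)
    fix R M assume c: "composing k a s (Suc s * b) R M"
    then have regs: "R r_src = a + 4 * s" "R r_four = 4" "R r_one = 1" "R r_next = a + 4 * b ^ k"
      by (simp_all add: composing_def tabled_def core_def)
    have "composing k a (Suc s) (Suc s * b) (R(r_src := a + 4 * s + 4, r_exit := v)) M" for v
      using c by (simp add: composing_def tabled_def core_def)
    then show "wp w [AddI r_src r_src r_four, AddI r_exit r_src r_one, SubI r_exit r_exit r_next]
      (\<lambda>R M. composing k a (Suc s) (Suc s * b) R M \<and> (R r_exit = 0 \<longleftrightarrow> Suc s < b ^ k)) R M"
      using ba[OF c] regs by auto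
  qed simp
  show ?thesis
    unfolding compose_row_def
    by (rule hoare_conseq[OF hoare_Seq[OF pre hoare_Seq[OF loop post]]]) auto
qed

text \<open>Each of the \<open>b ^ k\<close> rows adds 6 steps of its own to those of its
  \<open>b\<close> records; bounding \<open>b ^ k\<close> and \<open>b ^ Suc k\<close> by
  \<open>b ^ K\<close> turns 33 into 39.\<close>

lemma hoare_compose_table:
  assumes k: "k < K"
  shows "hoare w (tabled k a) (compose_table r) (b ^ K * (4 * r + 39) + 2 * r + 10)
    (\<lambda>R M. tabled (Suc k) (a + 4 * b ^ k) R M \<and> (R r_exit = 0 \<longleftrightarrow> 4 * b ^ Suc k \<le> n))"
proof -
  define I where "I i R M \<longleftrightarrow> (\<exists>s<b ^ k. i = b ^ k - 1 - s \<and> composing k a s (s * b) R M)"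
    for i and R M :: "nat \<Rightarrow> nat"
  have "hoare w (I i) (compose_row r) (b * (4 * r + 33) + 5)
      (\<lambda>R M. if R r_exit = 0 then \<exists>j<i. I j R M else composing k a (b ^ k) (b ^ k * b) R M)" for i
    unfolding I_def
  proof (intro hoare_exI)
    fix s
    let ?P = "\<lambda>R M. s < b ^ k \<and> i = b ^ k - 1 - s \<and> composing k a s (s * b) R M"
    show "hoare w ?P (compose_row r) (b * (4 * r + 33) + 5)
      (\<lambda>R M. if R r_exit = 0 then \<exists>j<i. \<exists>s<b ^ k. j = b ^ k - 1 - s \<and> composing k a s (s * b) R M
         else composing k a (b ^ k) (b ^ k * b) R M)"
    proof (rule hoare_pure[of ?P "s < b ^ k \<and> i = b ^ k - 1 - s"], simp)
      assume s: "s < b ^ k \<and> i = b ^ k - 1 - s"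
      show "hoare w ?P (compose_row r) (b * (4 * r + 33) + 5)
      (\<lambda>R M. if R r_exit = 0 then \<exists>j<i. \<exists>s<b ^ k. j = b ^ k - 1 - s \<and> composing k a s (s * b) R M
         else composing k a (b ^ k) (b ^ k * b) R M)"
      proof (rule hoare_conseq[OF hoare_compose_row[OF conjunct1[OF s] k, of a]], simp, goal_cases)
        case (1 R M)
        show ?case
        proof (cases "Suc s < b ^ k")
          case True
          moreover have "b ^ k - 1 - Suc s < i" using s True by auto
          ultimately have "\<exists>j<i. \<exists>s<b ^ k. j = b ^ k - 1 - s \<and> composing k a s (s * b) R M"
            using 1 by blast
          then show ?thesis using 1 True by auto
        next
          case False
          then have "Suc s = b ^ k" using s by auto
          then show ?thesis using 1 False by auto
        qed
      qed simp
    qed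
  qed
  note loop = hoare_RepeatUntil[of w I, OF this, of "b ^ k - 1"]
  have "b ^ k - 1 + 1 = b ^ k" using zero_less_power[OF nstates_pos[of r], of k] by linarith
  from loop[unfolded this]
  have loop: "hoare w (I (b ^ k - 1)) (RepeatUntil (compose_row r) r_exit)
      (b ^ k * (b * (4 * r + 33) + 6)) (composing k a (b ^ k) (b ^ k * b))"
    by (rule hoare_conseq) (simp_all add: add_Suc_right algebra_simps)
  have bk: "b ^ k + b ^ k \<le> b ^ Suc k" "b ^ Suc k \<le> b ^ K"
    using index_less[of 0 k 0] k by auto
  have lt: "a + 4 * b ^ k < 2 ^ w \<and> a + 4 * b ^ k \<le> D + 4 * b ^ Suc k \<and> Suc k < 2 ^ w" if "tabled k a R M" for R M
  proof -
    have "a \<le> D + 4 * b ^ k" using that by (simp add: tabled_def)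
    moreover have "k < b ^ k" using nstates_ge_2 by (meson less_exp power_mono order_less_le_trans zero_le)
    ultimately show ?thesis using bk w by linarith
  qed
  have pre: "hoare w (tabled k a)
     (Block (AddI r_next r_base r_size # copy r_dst r_next @ copy r_src r_base)) 5 (I (b ^ k - 1))"
  proof (rule hoare_Block)
    fix R M assume t: "tabled k a R M"
    then have regs: "R r_base = a" "R r_size = 4 * b ^ k" by (simp_all add: tabled_def)
    have "composing k a 0 0
       (R(r_next := a + 4 * b ^ k, r_dst := a + 4 * b ^ k, r_src := a)) M"
      using t by (simp add: composing_def tabled_def core_def is_table_def)
    then show "wp w (AddI r_next r_base r_size # copy r_dst r_next @ copy r_src r_base)
        (I (b ^ k - 1)) R M"
      using lt[OF t] unfolding I_def copy_def by (auto simp: regs intro!: exI[of _ 0])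
  qed (simp add: copy_def)
  have post: "hoare w (composing k a (b ^ k) (b ^ k * b))
     (Block (copy r_base r_next @ replicate (2 * r + 1) (AddI r_size r_size r_size) @
       [AddI r_k r_k r_one, SubI r_exit r_size r_n])) (2 * r + 5)
     (\<lambda>R M. tabled (Suc k) (a + 4 * b ^ k) R M \<and> (R r_exit = 0 \<longleftrightarrow> 4 * b ^ Suc k \<le> n))"
  proof (rule hoare_Block)
    fix R M assume c: "composing k a (b ^ k) (b ^ k * b) R M"
    then have t: "tabled k a R M" by (simp add: composing_def)
    have regs: "R r_next = a + 4 * b ^ k" "R r_size = 4 * b ^ k" "R r_k = k" "R r_n = n" "R r_one = 1"
      using c by (simp_all add: composing_def tabled_def core_def)
    have e: "4 * b ^ k * 2 ^ Suc (2 * r) = 4 * b ^ Suc k" by (simp add: nstates_def)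
    have l: "4 * b ^ Suc k < 2 ^ w" using bk w by linarith
    have "tabled (Suc k) (a + 4 * b ^ k)
       (R(r_base := a + 4 * b ^ k, r_size := 4 * b ^ Suc k, r_k := Suc k, r_exit := v)) M" for v
      using c lt[OF t] by (simp add: composing_def tabled_def core_def mult.commute)
    then show "wp w (copy r_base r_next @ replicate (2 * r + 1) (AddI r_size r_size r_size) @
       [AddI r_k r_k r_one, SubI r_exit r_size r_n])
       (\<lambda>R M. tabled (Suc k) (a + 4 * b ^ k) R M \<and> (R r_exit = 0 \<longleftrightarrow> 4 * b ^ Suc k \<le> n)) R M"
      unfolding copy_def wp_append
      using lt[OF t] l
      by (simp add: regs del: power_Suc)
        (rule wp_double; simp add: regs e add_Suc_right del: power_Suc)
  qed (simp add: copy_def)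
  have "b ^ k * (b * (4 * r + 33)) \<le> b ^ K * (4 * r + 33)"
    using mult_right_mono[OF bk(2), of "4 * r + 33"] by (simp add: algebra_simps)
  moreover have "b ^ k \<le> b ^ K" using bk by linarith
  ultimately have "5 + (b ^ k * (b * (4 * r + 33) + 6) + (2 * r + 5)) \<le> b ^ K * (4 * r + 39) + 2 * r + 10"
    by (simp add: algebra_simps)
  then show ?thesis
    unfolding compose_table_def
    by (intro hoare_conseq[OF hoare_Seq[OF pre hoare_Seq[OF loop post]]]) auto
qed

lemma hoare_compose_tables:
  "hoare w (tabled 1 D) (RepeatUntil (compose_table r) r_exit)
     ((K - 1) * (b ^ K * (4 * r + 39) + 2 * r + 11)) (\<lambda>R M. \<exists>a. tabled K a R M)"
proof -
  define I where "I i R M \<longleftrightarrow> (\<exists>k a. k < K \<and> i = K - 1 - k \<and> tabled k a R M)"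
    for i and R M :: "nat \<Rightarrow> nat"
  have "hoare w (I i) (compose_table r) (b ^ K * (4 * r + 39) + 2 * r + 10)
      (\<lambda>R M. if R r_exit = 0 then \<exists>j<i. I j R M else \<exists>a. tabled K a R M)" (is "hoare w _ _ _ (?Q i)") for i
    unfolding I_def
  proof (intro hoare_exI)
    fix k a
    let ?P = "\<lambda>R M. k < K \<and> i = K - 1 - k \<and> tabled k a R M"
    show "hoare w ?P (compose_table r) (b ^ K * (4 * r + 39) + 2 * r + 10)
      (\<lambda>R M. if R r_exit = 0 then \<exists>j<i. \<exists>k a. k < K \<and> j = K - 1 - k \<and> tabled k a R M
         else \<exists>a. tabled K a R M)"
    proof (rule hoare_pure[of ?P "k < K \<and> 1 \<le> k \<and> i = K - 1 - k"], simp add: tabled_def)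
      assume k: "k < K \<and> 1 \<le> k \<and> i = K - 1 - k"
      \<comment> \<open>The machine compares the table size with \<open>n\<close> and never knows
        \<open>K\<close>; by the choice of \<open>K\<close> as a least level, the test fires exactly
        there.\<close>
      have exit: "4 * b ^ Suc k \<le> n \<longleftrightarrow> Suc k < K"
        using K K_least[of "Suc k"] k by (cases "Suc k = K") auto
      show "hoare w ?P (compose_table r) (b ^ K * (4 * r + 39) + 2 * r + 10)
      (\<lambda>R M. if R r_exit = 0 then \<exists>j<i. \<exists>k a. k < K \<and> j = K - 1 - k \<and> tabled k a R M
         else \<exists>a. tabled K a R M)"
      proof (rule hoare_conseq[OF hoare_compose_table[OF conjunct1[OF k], of a]], simp, goal_cases)
        case (1 R M)
        show ?case
        proof (cases "Suc k < K")
          case True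
          moreover have "K - 1 - Suc k < i" using k True by auto
          ultimately have "\<exists>j<i. \<exists>k a. k < K \<and> j = K - 1 - k \<and> tabled k a R M"
            using 1 by blast
          then show ?thesis using 1 True exit by auto
        next
          case False
          then have "Suc k = K" using k by auto
          then show ?thesis using 1 False exit by auto
        qed
      qed simp
    qed
  qed
  note loop = hoare_RepeatUntil[of w I, OF this, of "K - 2"]
  have "K - 2 + 1 = K - 1" using K by simp
  moreover have "I (K - 2) R M" if "tabled 1 D R M" for R M
    unfolding I_def using that K by (intro exI[of _ 1] exI[of _ D]) auto
  ultimately show ?thesis
    by (intro hoare_conseq[OF loop]) auto
qed

section \<open>Passes over the row\<close>

definition running :: "(nat \<Rightarrow> nat) \<Rightarrow> nat \<Rightarrow> nat \<Rightarrow> nat \<Rightarrow> asn" where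
  "running y k a G R M \<longleftrightarrow> core y R M \<and> R r_k = k \<and> R r_base = a \<and> R r_gens = G \<and>
     ent M a k (b ^ k) \<and> k \<le> K \<and> D \<le> a \<and> a \<le> D + 4 * b ^ k"

lemma tstate_nxt_less: "tstate (nxt r h k) y p < b ^ k"
  by (cases p) (simp_all add: nxt_less)

text \<open>Overwriting in place is harmless: cell \<open>c\<close> is read before it is written,
  and all that the pass still needs from earlier cells is in \<open>r_st\<close>. Ten instructions
  and a jump per cell give the factor 11.\<close>

lemma hoare_update_row:
  assumes y: "\<And>p. y p \<le> 1"
  shows "hoare w (running y k a G) update_row (11 * D + 2) (running ((ca r h ^^ k) y) k a G)"
proof -
  let ?z = "tout (nxt r h k) (out r h k) y"
  let ?row = "\<lambda>c p. if p < c then ?z p else y p"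
  define I where "I i R M \<longleftrightarrow> (\<exists>c<D. i = D - 1 - c \<and> running (?row c) k a G R M \<and>
    R r_cell = c \<and> R r_st = 4 * tstate (nxt r h k) y c)" for i and R M :: "nat \<Rightarrow> nat"
  have "hoare w (I i) update_cell 10
      (\<lambda>R M. if R r_exit = 0 then \<exists>j<i. I j R M else running ?z k a G R M)" for i
    unfolding update_cell_def
  proof (rule hoare_Block)
    fix R M assume "I i R M"
    then obtain c where c: "c < D" "i = D - 1 - c" and run: "running (?row c) k a G R M"
      and regs: "R r_cell = c" "R r_st = 4 * tstate (nxt r h k) y c"
      unfolding I_def by blast
    let ?s = "tstate (nxt r h k) y c"
    have s: "?s < b ^ k" by (rule tstate_nxt_less)
    have t: "ent M a k (b ^ k)" and a: "D \<le> a" "a \<le> D + 4 * b ^ k" and k: "k \<le> K"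
      and regs': "R r_base = a" "R r_one = 1" "R r_two = 2" "R r_row = D" and M: "M c = y c"
      using run c by (auto simp: running_def core_def)
    note v = is_table_D[OF t s y[of c]]
    have v': "M (4 * ?s + a + y c) = 4 * tstate (nxt r h k) y (Suc c)" "M (4 * ?s + a + y c + 2) = ?z c"
      using v by (simp_all add: tout_def add.commute)
    have lt: "4 * ?s + a + y c + 2 < 2 ^ w" "c + 2 < 2 ^ w"
    proof -
      show "4 * ?s + a + y c + 2 < 2 ^ w" using s a y[of c] w b_pow[OF k] by linarith
      show "c + 2 < 2 ^ w" using c w by linarith
    qed
    have fin: "running (?row (Suc c)) k a G R' (M(c := ?z c))"
      if "\<And>q. q \<notin> {r_bit, r_addr, r_st, r_out, r_cell, r_exit} \<Longrightarrow> R' q = R q" for R'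
    proof -
      have "ent (M(c := ?z c)) a k N" if "ent M a k N" "c < a" for a k N
        using that unfolding is_table_def is_record_def by (auto simp: fun_upd_def)
      then show ?thesis
        using run that c a by (auto simp: running_def core_def fun_upd_def less_Suc_eq)
    qed
    show "wp w [LoadI r_bit r_cell, AddI r_addr r_st r_base, AddI r_addr r_addr r_bit,
     LoadI r_st r_addr, AddI r_addr r_addr r_two, LoadI r_out r_addr, StoreI r_cell r_out,
     AddI r_cell r_cell r_one, AddI r_exit r_cell r_one, SubI r_exit r_exit r_row]
     (\<lambda>R M. if R r_exit = 0 then \<exists>j<i. I j R M else running ?z k a G R M) R M"
    proof (cases "Suc c < D")
      case True
      have "\<exists>j<i. I j R' (M(c := ?z c))"
        if "\<And>q. q \<notin> {r_bit, r_addr, r_st, r_out, r_cell, r_exit} \<Longrightarrow> R' q = R q"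
          "R' r_cell = Suc c" "R' r_st = 4 * tstate (nxt r h k) y (Suc c)" for R'
        unfolding I_def using True c that fin[of R']
        by (intro exI[of _ "D - 1 - Suc c"] conjI exI[of _ "Suc c"]) auto
      then show ?thesis using lt True by (simp add: regs regs' M v' add_Suc_right)
    next
      case False
      have "running ?z k a G R' (M(c := ?z c))"
        if "\<And>q. q \<notin> {r_bit, r_addr, r_st, r_out, r_cell, r_exit} \<Longrightarrow> R' q = R q" for R'
        using fin[of R'] that False c by (auto simp: running_def core_def)
      then show ?thesis using lt False by (simp add: regs regs' M v' add_Suc_right)
    qed
  qed simp
  note loop = hoare_RepeatUntil[of w I, OF this, of "D - 1"]
  have D_pos: "0 < D" using D by linarith
  then have "D - 1 + 1 = D" by linarith
  note loop = loop[unfolded this]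
  have pre: "hoare w (running y k a G) (Block [ConstI r_cell 0, ConstI r_st 0]) 2 (I (D - 1))"
  proof (rule hoare_Block)
    fix R M assume "running y k a G R M"
    then have "I (D - 1) (R(r_cell := 0, r_st := 0)) M"
      unfolding I_def using D_pos by (intro exI[of _ 0]) (simp add: running_def core_def)
    then show "wp w [ConstI r_cell 0, ConstI r_st 0] (I (D - 1)) R M" by simp
  qed simp
  show ?thesis
    unfolding update_row_def
    by (rule hoare_conseq[OF hoare_Seq[OF pre loop]]) (simp_all add: tout_cascade)
qed

text \<open>An upper bound on the number of passes for \<open>G\<close> generations: with the large table, \<open>G div K\<close>
  passes and fewer than \<open>K\<close> single ones.\<close>

definition passes :: "nat \<Rightarrow> nat \<Rightarrow> nat \<Rightarrow> bool" where
  "passes k G i \<longleftrightarrow> k = K \<and> i = G div K + K \<or> k = 1 \<and> i = G"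

text \<open>The second part is a switch to the base table followed by one single pass. There
  \<open>G < K\<close> makes \<open>i = K\<close>, which exceeds the \<open>G - 1\<close> single
  passes that remain.\<close>

lemma passes_step:
  assumes "passes k G i" "0 < G"
  shows "k \<le> G \<Longrightarrow> \<exists>i'<i. passes k (G - k) i'" "G < k \<Longrightarrow> \<exists>i'<i. passes 1 (G - 1) i'"
proof -
  show "\<exists>i'<i. passes k (G - k) i'" if "k \<le> G"
    using assms(1) unfolding passes_def
  proof
    assume *: "k = K \<and> i = G div K + K"
    then have "G div K = Suc ((G - K) div K)" using that K by (intro le_div_geq) auto
    then show "\<exists>i'<i. k = K \<and> i' = (G - k) div K + K \<or> k = 1 \<and> i' = G - k"
      using * by (intro exI[of _ "(G - K) div K + K"]) auto
  next
    assume "k = 1 \<and> i = G"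
    then show "\<exists>i'<i. k = K \<and> i' = (G - k) div K + K \<or> k = 1 \<and> i' = G - k"
      using assms(2) by (intro exI[of _ "G - 1"]) auto
  qed
  show "\<exists>i'<i. passes 1 (G - 1) i'" if "G < k"
    using assms that unfolding passes_def by (intro exI[of _ "G - 1"]) auto
qed

lemma hoare_main_loop:
  "hoare w (\<lambda>R M. \<exists>a. tabled K a R M) main_loop (((n - 1) div K + K + 1) * (11 * D + 10) + 1)
     (\<lambda>R M. core ((ca r h ^^ (n - 1)) x) R M)"
proof -
  define I where "I i R M \<longleftrightarrow> (\<exists>j k a G. running ((ca r h ^^ j) x) k a G R M \<and> 0 < G \<and>
    j + G = n - 1 \<and> passes k G i)" for i and R M :: "nat \<Rightarrow> nat"
  \<comment> \<open>The midpoint of an iteration, when the table has been chosen and a pass of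
    \<open>k\<close> generations no longer overshoots.\<close>
  define J where "J i R M \<longleftrightarrow> (\<exists>j k a G. running ((ca r h ^^ j) x) k a G R M \<and> k \<le> G \<and>
    j + G = n - 1 \<and> (\<exists>i'<i. passes k (G - k) i'))" for i and R M :: "nat \<Rightarrow> nat"
  let ?Q = "\<lambda>R M. core ((ca r h ^^ (n - 1)) x) R M"
  let ?E = "\<lambda>i R M. if R r_exit = 0 then \<exists>j<i. I j R M else ?Q R M"
  have lt: "D + 4 < 2 ^ w" using w by linarith
  have tail: "hoare w (J i) (Block [SubI r_gens r_gens r_k] ;; update_row ;;
      Block [SubI r_exit r_one r_gens]) (1 + (11 * D + 2 + 1)) (?E i)" for i
    unfolding J_def
  proof (intro hoare_exI)
    fix j k a G
    let ?y = "(ca r h ^^ j) x"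
    let ?P = "\<lambda>R M. running ?y k a G R M \<and> k \<le> G \<and> j + G = n - 1 \<and> (\<exists>i'<i. passes k (G - k) i')"
    show "hoare w ?P (Block [SubI r_gens r_gens r_k] ;; update_row ;;
      Block [SubI r_exit r_one r_gens]) (1 + (11 * D + 2 + 1)) (?E i)"
    proof (rule hoare_pure[of ?P "k \<le> G \<and> j + G = n - 1 \<and> (\<exists>i'<i. passes k (G - k) i')"], blast)
      assume *: "k \<le> G \<and> j + G = n - 1 \<and> (\<exists>i'<i. passes k (G - k) i')"
      have 1: "hoare w ?P (Block [SubI r_gens r_gens r_k]) 1 (running ?y k a (G - k))"
        by (rule hoare_Block) (auto simp: running_def core_def)
      have 2: "hoare w (running ?y k a (G - k)) update_row (11 * D + 2)
          (running ((ca r h ^^ k) ?y) k a (G - k))"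
        by (rule hoare_update_row) (rule ca_le, rule x)
      have 3: "hoare w (running ((ca r h ^^ k) ?y) k a (G - k)) (Block [SubI r_exit r_one r_gens]) 1 (?E i)"
      proof (rule hoare_Block)
        fix R M assume run: "running ((ca r h ^^ k) ?y) k a (G - k) R M"
        let ?R = "R(r_exit := R r_one - R r_gens)"
        have y: "(ca r h ^^ k) ?y = (ca r h ^^ (k + j)) x" by (simp add: funpow_add)
        have run': "running ((ca r h ^^ (k + j)) x) k a (G - k) ?R M"
          using run unfolding y by (simp add: running_def core_def)
        have e: "?R r_exit = 1 - (G - k)" using run by (simp add: running_def core_def)
        have "?E i ?R M"
        proof (cases "G - k = 0")
          case True
          then have "k + j = n - 1" using * by simp
          then show ?thesis using run' e True by (auto simp: running_def)
        next
          case False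
          have "k + j + (G - k) = n - 1" using * by simp
          then have "\<exists>i'<i. I i' ?R M" unfolding I_def using run' False * by blast
          then show ?thesis using e False by simp
        qed
        then show "wp w [SubI r_exit r_one r_gens] (?E i) R M" by simp
      qed simp
      show ?thesis
        by (rule hoare_Seq[OF 1 hoare_Seq[OF 2 3]])
    qed
  qed
  have first: "hoare w (I i) (Block [SubI r_exit r_k r_gens]) 1
      (\<lambda>R M. I i R M \<and> R r_exit = R r_k - R r_gens)" for i
    by (rule hoare_Block) (auto simp: I_def running_def core_def)
  have switch: "hoare w (\<lambda>R M. I i R M \<and> R r_exit = R r_k - R r_gens)
      (IfNZ r_exit (Block (ConstI r_k 1 # copy r_base r_row))) (3 + 1) (J i)" for i
  proof (rule hoare_IfNZ[OF hoare_Block])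
    fix R M assume *: "(I i R M \<and> R r_exit = R r_k - R r_gens) \<and> R r_exit \<noteq> 0"
    then obtain j k a G where run: "running ((ca r h ^^ j) x) k a G R M" "0 < G" "j + G = n - 1"
      "passes k G i" unfolding I_def by blast
    then have "G < k" using * by (auto simp: running_def)
    then obtain i' where i': "i' < i" "passes 1 (G - 1) i'" using passes_step(2)[OF run(4,2)] by blast
    \<comment> \<open>\<open>core\<close> has preserved the base table at \<open>D\<close>
      throughout, so the switch only resets two registers.\<close>
    have "running ((ca r h ^^ j) x) 1 D G (R(r_k := 1, r_base := D)) M"
      using run(1) K b_le by (simp add: running_def core_def)
    then have "J i (R(r_k := 1, r_base := D)) M"
      unfolding J_def using run(2,3) i'
      by (intro exI[of _ j] exI[of _ 1] exI[of _ D] exI[of _ G]) auto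
    moreover have "R r_row = D" using run(1) by (simp add: running_def core_def)
    ultimately show "wp w (ConstI r_k 1 # copy r_base r_row) (J i) R M"
      unfolding copy_def using lt by (simp add: fun_upd_twist)
  next
    fix R M assume *: "I i R M \<and> R r_exit = R r_k - R r_gens" "R r_exit = 0"
    then obtain j k a G where run: "running ((ca r h ^^ j) x) k a G R M" "0 < G" "j + G = n - 1"
      "passes k G i" unfolding I_def by blast
    then have "k \<le> G" using * by (simp add: running_def)
    then show "J i R M"
      unfolding J_def using run passes_step(1)[OF run(4,2)] by blast
  qed (simp add: copy_def)
  have "hoare w (I i) (Block [SubI r_exit r_k r_gens] ;;
     IfNZ r_exit (Block (ConstI r_k 1 # copy r_base r_row)) ;;
     Block [SubI r_gens r_gens r_k] ;; update_row ;; Block [SubI r_exit r_one r_gens]) (11 * D + 9) (?E i)" for i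
    by (rule hoare_conseq[OF hoare_Seq[OF first hoare_Seq[OF switch tail]]]) auto
  note loop = hoare_RepeatUntil[of w I, OF this, of "(n - 1) div K + K"]
  have start: "I ((n - 1) div K + K) R M" if "tabled K a R M" "R r_gens \<noteq> 0" for a R M
    unfolding I_def using that
    by (intro exI[of _ 0] exI[of _ K] exI[of _ a] exI[of _ "n - 1"])
      (auto simp: passes_def running_def tabled_def)
  show ?thesis
    unfolding main_loop_def
  proof (rule hoare_IfNZ)
    show "hoare w (\<lambda>R M. (\<exists>a. tabled K a R M) \<and> R r_gens \<noteq> 0)
      (RepeatUntil (Block [SubI r_exit r_k r_gens] ;;
       IfNZ r_exit (Block (ConstI r_k 1 # copy r_base r_row)) ;;
       Block [SubI r_gens r_gens r_k] ;; update_row ;; Block [SubI r_exit r_one r_gens]) r_exit)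
      (((n - 1) div K + K + 1) * (11 * D + 10)) ?Q"
      by (rule hoare_conseq[OF loop]) (use start in auto)
  qed (auto simp: tabled_def)
qed

definition time_bound :: nat where
  "time_bound = 20 + 2 * r + 12 * b + ((K - 1) * (b ^ K * (4 * r + 39) + 2 * r + 11) +
     (((n - 1) div K + K + 1) * (11 * D + 10) + 1 + 2))"

lemma hoare_program:
  "hoare w (\<lambda>R M. R r_n = n \<and> R r_m = m \<and> (\<forall>p. M p = x p)) (program r h) time_bound
     (\<lambda>R M. R r_n = 2 * r * (n - 1) \<and> (\<forall>p<D. M p = (ca r h ^^ (n - 1)) x p))"
proof -
  have last: "hoare w (\<lambda>R M. core ((ca r h ^^ (n - 1)) x) R M) (Block (copy r_n r_result)) 2
     (\<lambda>R M. R r_n = 2 * r * (n - 1) \<and> (\<forall>p<D. M p = (ca r h ^^ (n - 1)) x p))"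
  proof (rule hoare_Block)
    have "2 * r * (n - 1) < 2 ^ w" using w D by linarith
    then show "wp w (copy r_n r_result) (\<lambda>R M. R r_n = 2 * r * (n - 1) \<and>
        (\<forall>p<D. M p = (ca r h ^^ (n - 1)) x p)) R M"
      if "core ((ca r h ^^ (n - 1)) x) R M" for R M
      using that by (simp add: copy_def core_def)
  qed (simp add: copy_def)
  show ?thesis
    unfolding program_def time_bound_def
    by (intro hoare_Seq[OF hoare_prepare hoare_Seq[OF hoare_compose_tables hoare_Seq[OF hoare_main_loop last]]])
qed

end

section \<open>From the triple to runs of prescribed length\<close>

lemma run_halted: "halted p s \<Longrightarrow> run p t s = s"
  unfolding run_def by (induction t) (auto simp: step_def)

lemma (in ca_run) computes_generation:
  assumes x_eq: "\<And>p. x p = (if p < m + 2 * r * (n - 1)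
     then of_bool (X (a - int (r * (n - 1)) + int p)) else 0)"
  shows "computes_generation (assemble 0 (program r h)) r h X n a m time_bound w"
proof -
  let ?p = "assemble 0 (program r h)" and ?s = "input_state r X n a m" and ?c = "a - int (r * (n - 1))"
  let ?R = "((\<lambda>_. 0)(0 := n, 1 := m)) :: nat \<Rightarrow> nat"
  have s: "?s = Ram_State 0 ?R x"
    unfolding input_state_def by (simp add: x_eq fun_eq_iff)
  have "n < 2 ^ w" "m < 2 ^ w" "1 < (2::nat) ^ w" using w D by linarith+
  moreover have "x q < 2 ^ w" for q using x[of q] \<open>1 < 2 ^ w\<close> by linarith
  ultimately have fits: "fits_words w (Ram_State 0 ?R x)"
    by (auto simp: fits_words_def fun_upd_def)
  have code: "code_at ?p 0 ?p" by (auto simp: code_at_def)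
  have init: "?R r_n = n \<and> ?R r_m = m \<and> (\<forall>p. x p = x p)" by simp
  obtain u R' M' where u: "u \<le> time_bound"
    and post: "R' r_n = 2 * r * (n - 1) \<and> (\<forall>p<D. M' p = (ca r h ^^ (n - 1)) x p)"
    and runs: "runs w ?p ?s u (Ram_State (0 + csize (program r h)) R' M')"
    unfolding s by (rule hoareD[OF hoare_program code init fits]) blast
  let ?t = "Ram_State (0 + csize (program r h)) R' M'"
  have halted: "halted ?p ?t" by (simp add: halted_def)
  \<comment> \<open>A halted state is a fixed point, so a run that ends early can be padded to
    exactly \<open>time_bound\<close> steps.\<close>
  have final: "run ?p v ?s = ?t" if "u \<le> v" for v
    using runs run_add[of ?p u "v - u" ?s] run_halted[OF halted] that by (simp add: runs_def)
  have "fits_words w (run ?p v ?s)" for v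
    using runs final[of v] fits_words_runs[OF runs] by (cases "u \<le> v") (auto simp: runs_def)
  moreover have "stores_segment ?t (generation r h X n) a m"
    unfolding stores_segment_def
  proof (intro allI impI)
    fix k assume k: "k < m"
    let ?q = "2 * r * (n - 1) + k"
    have "mem ?t (reg ?t 0 + k) = (ca r h ^^ (n - 1)) x ?q"
      using post k D by simp
    \<comment> \<open>\<open>L\<close> stops short of the junk cell at position
      \<open>D - 1\<close>. The shift by \<open>r * (n - 1)\<close> and the offset of
      \<open>?c\<close> then cancel against the \<open>2 * r * (n - 1)\<close> discarded
      cells.\<close>
    also have "\<dots> = of_bool ((global_update r h ^^ (n - 1)) X (?c + int ?q - int (r * (n - 1))))"
      using k by (intro ca_pow_eq[where L = "m + 2 * r * (n - 1)"] x) (auto simp: x_eq)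
    also have "?c + int ?q - int (r * (n - 1)) = a + int k" by simp
    finally show "mem ?t (reg ?t 0 + k) = of_bool (generation r h X n (a + int k))"
      by (simp add: generation_def)
  qed
  ultimately show ?thesis
    unfolding computes_generation_def Let_def using final[OF u] halted by simp
qed

theorem theorem1:
  fixes r :: nat and h :: "bool list \<Rightarrow> bool"
  shows "\<exists>p :: instr list. \<forall>len :: nat \<Rightarrow> nat.
           (\<lambda>n. real (len n)) \<in> O(\<lambda>n. real n) \<longrightarrow>
           (\<exists>T W :: nat \<Rightarrow> nat.
              (\<lambda>n. real (T n)) \<in> O(\<lambda>n. (real n)\<^sup>2 / ln (real n)) \<and>
              (\<lambda>n. real (W n)) \<in> O(\<lambda>n. ln (real n)) \<and>
              (\<forall>n\<ge>1. \<forall>(X :: config) (a :: int).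
                 computes_generation p r h X n a (len n) (T n) (W n)))"
proof (intro exI[of _ "assemble 0 (program r h)"] allI impI)
  fix len :: "nat \<Rightarrow> nat"
  assume len: "(\<lambda>n. real (len n)) \<in> O(\<lambda>n. real n)"
  define b where "b = nstates r"
  define K where "K = num_levels b"
  define D where "D n = 2 * r * (n - 1) + len n + 1" for n
  define Z where "Z n = D n + 8 * b ^ K n + n + 8" for n
  define W where "W n = (LEAST w. Z n \<le> 2 ^ w)" for n
  define T where "T n = ca_run.time_bound r n (K n) (D n)" for n
  have b: "2 \<le> b" unfolding b_def by (rule nstates_ge_2)
  note K = num_levels[OF b, folded K_def]
  note KO = num_levels_asymp[OF b, folded K_def]
  have run: "ca_run r n (len n) (K n) (W n) (D n) x" if "1 \<le> n" "\<And>p. x p \<le> 1" for n and x :: "nat \<Rightarrow> nat"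
  proof
    \<comment> \<open>\<open>Z n\<close> itself is an admissible exponent, so the least one
      exists.\<close>
    have "Z n \<le> 2 ^ W n" unfolding W_def by (rule LeastI[of _ "Z n"]) (simp add: less_imp_le)
    then show "D n + 8 * nstates r ^ K n + n + 8 \<le> 2 ^ W n" by (simp add: Z_def b_def)
  qed (use K that in \<open>auto simp: b_def D_def\<close>)
  have const: "(\<lambda>n. c) \<in> O(\<lambda>n. real n)" for c :: real by real_asymp
  have "(\<lambda>n. real (2 * r) * real (n - 1)) \<in> O(\<lambda>n. real n)"
    by (rule bigoI[where c = "real (2 * r)"]) (auto simp: mult_left_mono)
  from sum_in_bigo(1)[OF sum_in_bigo(1)[OF this len] const[of 1]]
  have DO: "(\<lambda>n. real (D n)) \<in> O(\<lambda>n. real n)" by (simp add: D_def)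
  have lin: "(\<lambda>n. f n * c) \<in> O(\<lambda>n. real n)" if "f \<in> O(\<lambda>n. real n)" for f and c :: real
    using landau_o.big.mult[OF that bigo_const[of c]] by simp
  have "(\<lambda>n. real (D n) + real (b ^ K n) * 8 + real n + 8) \<in> O(\<lambda>n. real n)"
    by (intro sum_in_bigo(1) DO const lin KO(1) landau_o.big_refl)
  then have ZO: "(\<lambda>n. real (Z n)) \<in> O(\<lambda>n. real n)" by (simp add: Z_def mult.commute)
  have "(\<lambda>n. real (T n)) \<in> O(\<lambda>n. real (20 + 2 * r + 12 * b) +
      (real (K n) * (real (b ^ K n) * real (4 * r + 39) + real (2 * r + 11)) +
       ((real ((n - 1) div K n) + real (K n) + 1) * (real (D n) * 11 + 10) + 3)))"
  proof (rule eventually_le_imp_bigo, rule eventually_sequentiallyI[of 1])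
    fix n :: nat assume n: "1 \<le> n"
    have "T n = 20 + 2 * r + 12 * b + ((K n - 1) * (b ^ K n * (4 * r + 39) + 2 * r + 11) +
        (((n - 1) div K n + K n + 1) * (11 * D n + 10) + 1 + 2))"
      \<comment> \<open>The zero row merely supplies an instance of the locale; the bound does not
        mention the row.\<close>
      unfolding T_def b_def by (rule ca_run.time_bound_def[OF run[OF n, of "\<lambda>_. 0"]]) simp
    also have "\<dots> \<le> 20 + 2 * r + 12 * b + (K n * (b ^ K n * (4 * r + 39) + 2 * r + 11) +
        (((n - 1) div K n + K n + 1) * (11 * D n + 10) + 1 + 2))"
      by (intro add_mono mult_le_mono order.refl diff_le_self)
    finally have "real (T n) \<le> real \<dots>" by (rule of_nat_mono)
    also have "\<dots> = real (20 + 2 * r + 12 * b) +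
      (real (K n) * (real (b ^ K n) * real (4 * r + 39) + real (2 * r + 11)) +
       ((real ((n - 1) div K n) + real (K n) + 1) * (real (D n) * 11 + 10) + 3))"
      by (simp add: algebra_simps add_Suc_right)
    finally show "real (T n) \<le> \<dots>" .
  qed
  also have "(\<lambda>n. real (20 + 2 * r + 12 * b) +
      (real (K n) * (real (b ^ K n) * real (4 * r + 39) + real (2 * r + 11)) +
       ((real ((n - 1) div K n) + real (K n) + 1) * (real (D n) * 11 + 10) + 3)))
      \<in> O(\<lambda>n. (real n)\<^sup>2 / ln (real n))"
  proof (intro sum_in_bigo(1))
    show "(\<lambda>n. c) \<in> O(\<lambda>n. (real n)\<^sup>2 / ln (real n))" for c :: real by real_asymp
    show "(\<lambda>n. 3) \<in> O(\<lambda>n. (real n)\<^sup>2 / ln (real n))" by real_asymp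
    \<comment> \<open>The construction of the tables: \<open>K n\<close> levels of linear cost, well
      below \<open>n^2 / ln n\<close>.\<close>
    have "(\<lambda>n. real (K n) * (real (b ^ K n) * real (4 * r + 39) + real (2 * r + 11)))
        \<in> O(\<lambda>n. ln (real n) * real n)"
      by (intro landau_o.big.mult sum_in_bigo(1) KO lin const)
    also have "(\<lambda>n. ln (real n) * real n) \<in> O(\<lambda>n. (real n)\<^sup>2 / ln (real n))"
      by real_asymp
    finally show "(\<lambda>n. real (K n) * (real (b ^ K n) * real (4 * r + 39) + real (2 * r + 11)))
        \<in> O(\<lambda>n. (real n)\<^sup>2 / ln (real n))" .
    \<comment> \<open>The at most \<open>K n\<close> single passes at the end are absorbed by the
      \<open>n / ln n\<close> large ones; each pass is linear.\<close>
    have "(\<lambda>n. ln (real n)) \<in> O(\<lambda>n. real n / ln (real n))" by real_asymp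
    then have "(\<lambda>n. real (K n)) \<in> O(\<lambda>n. real n / ln (real n))"
      by (rule landau_o.big.trans[OF KO(2)])
    moreover have "(\<lambda>n. 1) \<in> O(\<lambda>n. real n / ln (real n))" by real_asymp
    ultimately have "(\<lambda>n. (real ((n - 1) div K n) + real (K n) + 1) * (real (D n) * 11 + 10))
        \<in> O(\<lambda>n. real n / ln (real n) * real n)"
      by (intro landau_o.big.mult sum_in_bigo(1) KO lin const DO)
    then show "(\<lambda>n. (real ((n - 1) div K n) + real (K n) + 1) * (real (D n) * 11 + 10))
        \<in> O(\<lambda>n. (real n)\<^sup>2 / ln (real n))"
      by (simp add: power2_eq_square)
  qed
  finally have "(\<lambda>n. real (T n)) \<in> O(\<lambda>n. (real n)\<^sup>2 / ln (real n))" .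
  moreover have "(\<lambda>n. real (W n)) \<in> O(\<lambda>n. ln (real n))"
    unfolding W_def by (rule Least_power_asymp[OF ZO])
  moreover have "computes_generation (assemble 0 (program r h)) r h X n a (len n) (T n) (W n)"
    if "1 \<le> n" for n X a
    unfolding T_def by (rule ca_run.computes_generation[OF run[OF that]]) auto
  ultimately show "\<exists>T W :: nat \<Rightarrow> nat.
      (\<lambda>n. real (T n)) \<in> O(\<lambda>n. (real n)\<^sup>2 / ln (real n)) \<and>
      (\<lambda>n. real (W n)) \<in> O(\<lambda>n. ln (real n)) \<and>
      (\<forall>n\<ge>1. \<forall>(X :: config) (a :: int).
         computes_generation (assemble 0 (program r h)) r h X n a (len n) (T n) (W n))"
    by blast
qed

end
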